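(* Let $m \geq 2$, let $D \subset \mathbb{R}^m$ be a domain, let $\mu > 0$, and let a real-valued $v \in C^2(D)$ satisfy $\nabla^2 v - \mu^2 v = 0$ in $D$. Then $$\int_{\partial B_r(x)} \frac{\partial v}{\partial n_y} \, dS_y = \mu^2 \left( \frac{2\pi r}{\mu} \right)^{m/2} I_{m/2}(\mu r) \, v(x)$$ for every admissible ball $B_r(x)$.
   Context: A domain is an open connected subset of $\mathbb{R}^m$. $B_r(x) = \{ y : |y-x| < r\}$ with $x \in D$, $r > 0$; the ball is called admissible if $\overline{B_r(x)} \subset D$. $n$ denotes the exterior unit normal to $\partial B_r(x)$, $dS$ the surface measure, and $I_\nu$ the modified Bessel function of the first kind of order $\nu$. *)

theory Defs
  imports "HOL-Analysis.Analysis"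
begin

definition dir_deriv :: "('a::real_normed_vector \<Rightarrow> real) \<Rightarrow> 'a \<Rightarrow> 'a \<Rightarrow> real" where
  "dir_deriv f u x = deriv (\<lambda>t. f (x + t *\<^sub>R u)) 0"

(* A function is C^1 on an open set iff its partial derivatives exist and are continuous there;
   C^2 is C^1 with all first partial derivatives C^1 again. Since deriv is total, existence of
   the derivatives has to be demanded explicitly. *)
definition C1_on :: "'a::euclidean_space set \<Rightarrow> ('a \<Rightarrow> real) \<Rightarrow> bool" where
  "C1_on D f \<longleftrightarrow> continuous_on D f \<and>
     (\<forall>b\<in>Basis. (\<forall>x\<in>D. (\<lambda>t. f (x + t *\<^sub>R b)) differentiable (at 0)) \<and>
                 continuous_on D (dir_deriv f b))"

definition C2_on :: "'a::euclidean_space set \<Rightarrow> ('a \<Rightarrow> real) \<Rightarrow> bool" where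
  "C2_on D f \<longleftrightarrow> C1_on D f \<and> (\<forall>b\<in>Basis. C1_on D (dir_deriv f b))"

definition laplacian :: "('a::euclidean_space \<Rightarrow> real) \<Rightarrow> 'a \<Rightarrow> real" where
  "laplacian f x = (\<Sum>b\<in>Basis. dir_deriv (dir_deriv f b) b x)"

definition outward_normal :: "'a::real_normed_vector \<Rightarrow> real \<Rightarrow> 'a \<Rightarrow> 'a" where
  "outward_normal x r y = (y - x) /\<^sub>R r"

definition radial_proj :: "'a::real_normed_vector \<Rightarrow> real \<Rightarrow> 'a \<Rightarrow> 'a" where
  "radial_proj x r y = x + (r / norm (y - x)) *\<^sub>R (y - x)"

(* Surface measure on the sphere of radius r > 0 about x, normalized as in polar coordinates:
   a Borel set A of the sphere gets DIM / r times the Lebesgue measure of the cone with apex x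
   and base A. The lemmas below establish the cone formula, concentration on the sphere, the
   classical total mass 2 pi^(m/2) r^(m-1) / Gamma(m/2), and rotation invariance (the latter
   over well-ordered index types, where the library provides invariance of Lebesgue measure). *)
definition sphere_measure :: "'a::euclidean_space \<Rightarrow> real \<Rightarrow> 'a measure" where
  "sphere_measure x r =
     scale_measure (ennreal (real DIM('a) / r))
       (distr (restrict_space lborel (ball x r - {x})) borel (radial_proj x r))"

(* Only meaningful for z > 0 here: powr is 0 at base 0. *)
definition Bessel_I :: "real \<Rightarrow> real \<Rightarrow> real" where
  "Bessel_I \<nu> z = (\<Sum>k. (z / 2) powr (2 * real k + \<nu>) / (fact k * Gamma (\<nu> + real k + 1)))"

lemma borel_measurable_radial_proj [measurable]:
  "radial_proj x r \<in> borel_measurable (borel :: 'a::euclidean_space measure)"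
  unfolding radial_proj_def by measurable

lemma emeasure_sphere_measure:
  fixes x :: "'a::euclidean_space"
  assumes A: "A \<in> sets borel"
  shows "emeasure (sphere_measure x r) A =
           ennreal (real DIM('a) / r) * emeasure lborel {y \<in> ball x r - {x}. radial_proj x r y \<in> A}"
proof -
  have m: "radial_proj x r \<in> measurable (restrict_space lborel (ball x r - {x})) borel"
    by (intro measurable_restrict_space1) simp
  have "emeasure (distr (restrict_space lborel (ball x r - {x})) borel (radial_proj x r)) A =
    emeasure (restrict_space lborel (ball x r - {x}))
      (radial_proj x r -` A \<inter> space (restrict_space lborel (ball x r - {x})))"
    by (rule emeasure_distr[OF m A])
  also have "\<dots> = emeasure lborel
      (radial_proj x r -` A \<inter> space (restrict_space lborel (ball x r - {x})))"
    by (rule emeasure_restrict_space) (auto simp: space_restrict_space)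
  also have "radial_proj x r -` A \<inter> space (restrict_space lborel (ball x r - {x})) =
      {y \<in> ball x r - {x}. radial_proj x r y \<in> A}"
    by (auto simp: space_restrict_space)
  finally show ?thesis by (simp add: sphere_measure_def)
qed

lemma radial_proj_in_sphere:
  assumes "r > 0" "y \<noteq> x"
  shows "radial_proj x r y \<in> sphere x r"
  using assms by (simp add: radial_proj_def dist_norm)

lemma emeasure_sphere_measure_compl:
  fixes x :: "'a::euclidean_space"
  assumes "r > 0"
  shows "emeasure (sphere_measure x r) (- sphere x r) = 0"
proof -
  have "{y \<in> ball x r - {x}. radial_proj x r y \<in> - sphere x r} = {}"
    using radial_proj_in_sphere[OF assms] by blast
  moreover have "- sphere x r \<in> sets borel"
    using borel_comp[OF borel_closed[OF closed_sphere[of x r]]] .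
  ultimately show ?thesis
    using emeasure_sphere_measure[of "- sphere x r" x r] by (simp only: emeasure_empty mult_zero_right)
qed

lemma emeasure_sphere_measure_sphere:
  fixes x :: "'a::euclidean_space"
  assumes "r > 0"
  shows "emeasure (sphere_measure x r) (sphere x r) =
           ennreal (2 * pi powr (real DIM('a) / 2) / Gamma (real DIM('a) / 2) * r ^ (DIM('a) - 1))"
proof -
  have "{y \<in> ball x r - {x}. radial_proj x r y \<in> sphere x r} = ball x r - {x}"
    using radial_proj_in_sphere[OF assms] by blast
  moreover have "emeasure lborel (ball x r - {x}) = emeasure lborel (ball x r)"
    by (rule emeasure_Diff_null_set) (auto intro: finite_imp_null_set_lborel)
  moreover have "sphere x r \<in> sets borel" by (simp add: borel_closed)
  ultimately have "emeasure (sphere_measure x r) (sphere x r) =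
      ennreal (real DIM('a) / r) * ennreal (unit_ball_vol (real DIM('a)) * r ^ DIM('a))"
    using assms by (simp add: emeasure_sphere_measure emeasure_ball)
  also have "\<dots> = ennreal (real DIM('a) / r * (unit_ball_vol (real DIM('a)) * r ^ DIM('a)))"
    using assms by (intro ennreal_mult[symmetric]) auto
  also have "real DIM('a) / r * (unit_ball_vol (real DIM('a)) * r ^ DIM('a)) =
      2 * pi powr (real DIM('a) / 2) / Gamma (real DIM('a) / 2) * r ^ (DIM('a) - 1)"
  proof -
    have alg: "d / r * (P / G' * (r * R)) = 2 * P / G * R"
      if "G' = d / 2 * G" "G > 0" "d > 0" for d P G G' R :: real
      unfolding that(1) using that(2,3) assms by (simp add: field_simps)
    have "Gamma (real DIM('a) / 2 + 1) = real DIM('a) / 2 * Gamma (real DIM('a) / 2)"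
      by (rule Gamma_plus1) (metis DIM_positive divide_pos_pos nonpos_Ints_nonpos not_le
          of_nat_0_less_iff zero_less_numeral)
    moreover have "Gamma (real DIM('a) / 2) > 0" by (rule Gamma_real_pos) simp
    moreover have "r ^ DIM('a) = r * r ^ (DIM('a) - 1)"
      by (metis DIM_positive power_minus_mult mult.commute)
    ultimately show ?thesis
      using alg[of "Gamma (real DIM('a) / 2 + 1)" "real DIM('a)" "Gamma (real DIM('a) / 2)"]
      by (simp only: unit_ball_vol_def) simp
  qed
  finally show ?thesis .
qed

lemma emeasure_sphere_measure_rotation:
  fixes x :: "real ^ 'm::{finite,wellorder}"
  assumes r: "r > 0" and T: "orthogonal_transformation T" and A: "A \<in> sets borel"
  shows "emeasure (sphere_measure x r) ((\<lambda>y. x + T (y - x)) ` A) = emeasure (sphere_measure x r) A"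
proof -
  define g where "g y = x + T (y - x)" for y
  define h where "h y = x + inv T (y - x)" for y
  have lin: "linear T" and bij: "bij T"
    using T orthogonal_transformation_bij by (auto simp: orthogonal_transformation_def)
  have T': "orthogonal_transformation (inv T)"
    using T by (rule orthogonal_transformation_inv)
  have gh [simp]: "g (h y) = y" "h (g y) = y" for y
    using bij by (simp_all add: g_def h_def bij_is_surj surj_f_inv_f bij_is_inj)
  have vim: "g ` S = h -` S" for S by (auto simp: image_iff) (metis gh)+
  have hm: "h \<in> borel_measurable borel"
  proof -
    have "bounded_linear (inv T)"
      using orthogonal_transformation_linear[OF T'] by (simp add: linear_conv_bounded_linear)
    then have "continuous_on UNIV (\<lambda>y. x + inv T (y - x))"
      by (rule continuous_on_add[OF continuous_on_const bounded_linear.continuous_on])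
        (rule continuous_on_diff[OF continuous_on_id continuous_on_const])
    then show ?thesis unfolding h_def[abs_def] by (rule borel_measurable_continuous_onI)
  qed
  have gA: "g ` A \<in> sets borel"
    unfolding vim using measurable_sets_borel[OF hm A] .
  define E where "E = {y \<in> ball x r - {x}. radial_proj x r y \<in> A}"
  have E: "E \<in> sets borel"
  proof -
    have "E = (ball x r - {x}) \<inter> radial_proj x r -` A" by (auto simp: E_def)
    then show ?thesis
      using measurable_sets_borel[OF borel_measurable_radial_proj A, of x r] by simp
  qed
  have nT: "norm (T z) = norm z" for z
    using T by (simp add: orthogonal_transformation_norm)
  have ge: "radial_proj x r (g y) = g (radial_proj x r y)" for y
    by (simp add: radial_proj_def g_def nT linear_cmul[OF lin])
  have gx: "g y = x \<longleftrightarrow> y = x" and gb: "g y \<in> ball x r \<longleftrightarrow> y \<in> ball x r" for y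
    using nT[of "y - x"] by (auto simp: g_def dist_norm norm_minus_commute)
  have "{y \<in> ball x r - {x}. radial_proj x r y \<in> g ` A} = g ` E"
  proof (intro set_eqI)
    fix y
    have "y = g (h y)" by simp
    then obtain z where z: "y = g z" by blast
    have inj: "inj g" by (metis gh(2) injI)
    show "y \<in> {y \<in> ball x r - {x}. radial_proj x r y \<in> g ` A} \<longleftrightarrow> y \<in> g ` E"
      unfolding z by (simp add: ge gx gb[unfolded mem_ball] inj_image_mem_iff[OF inj] E_def)
  qed
  moreover have "emeasure lborel (g ` E) = emeasure lborel E"
  proof -
    have gE: "g ` E \<in> sets borel"
      unfolding vim using measurable_sets_borel[OF hm E] .
    have bE: "bounded E"
      by (rule bounded_subset[OF bounded_ball[of x r]]) (auto simp: E_def)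
    have lmE: "E \<in> lmeasurable"
      by (rule bounded_set_imp_lmeasurable[OF bE]) (use E in auto)
    let ?F = "(\<lambda>y. -x + y) ` E"
    have F: "?F \<in> lmeasurable" by (rule measurable_translation[OF lmE])
    have "g ` E = (+) x ` (T ` ?F)" by (auto simp: g_def image_image)
    moreover have "T ` ?F \<in> lmeasurable"
      by (rule measurable_orthogonal_image[OF T F])
    ultimately have lm: "g ` E \<in> lmeasurable" and "measure lebesgue (g ` E) = measure lebesgue E"
      using measurable_translation[of "T ` ?F" x] measure_translation[of x "T ` ?F"]
        measure_orthogonal_image[OF T F] measure_translation[of "-x" E] by auto
    then have "emeasure lebesgue (g ` E) = emeasure lebesgue E"
      using lmE lm by (simp add: emeasure_eq_measure2 fmeasurableD2)
    then show ?thesis using E gE by simp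
  qed
  ultimately show ?thesis
    using A gA unfolding g_def[symmetric] by (simp add: emeasure_sphere_measure E_def)
qed

end

theory Submission
  imports Defs
begin

text \<open>
  Write \<open>m\<close> for the dimension, \<open>A(s)\<close> for the integral of \<open>v\<close> over the ball of radius \<open>s\<close> about
  \<open>x\<close>, and \<open>m U(s)\<close> for the integral of \<open>\<omega> \<mapsto> v(x + s \<omega>)\<close> over the unit sphere. Then
  \<open>A' = m s\<^bsup>m-1\<^esup> U\<close>, and the divergence theorem gives \<open>m s\<^bsup>m-1\<^esup> U' = \<mu>\<^sup>2 A\<close>, the left side being the
  flux of \<open>\<nabla>v\<close>. The functions \<open>\<Phi>(s) = (2 \<pi> s / \<mu>)\<^bsup>m/2\<^esup> I\<^bsub>m/2\<^esub>(\<mu> s)\<close> and \<open>W = \<Phi>' / (m s\<^bsup>m-1\<^esup>)\<close>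
  satisfy the same system. Since \<open>A\<close> and \<open>\<Phi>\<close> vanish at \<open>0\<close>, the Wronskian \<open>A W - \<Phi> U\<close> is zero, so
  \<open>(U / W)' = 0\<close> and \<open>U / W\<close> equals its value \<open>v(x)\<close> at \<open>0\<close>; hence \<open>A = v(x) \<Phi>\<close>.

  Surface measure is defined by cones, so the divergence theorem is derived from translation invariance
  of Lebesgue measure alone: with \<open>\<rho> = |y - x|\<close>, the field \<open>(s\<^sup>2 - \<rho>\<^sup>2)\<^sup>2 \<nabla>v\<close>, extended by zero outside the
  ball, has a divergence of integral zero. Differentiating this identity twice in \<open>s\<close> leaves the
  integral of the Laplacian over the ball on one side and the flux on the other.
\<close>

subsection \<open>Differentiation under the integral and continuous partial derivatives\<close>

text \<open>The mean value inequality bounds every difference quotient by \<open>w\<close>, so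
  dominated convergence applies along each sequence tending to \<open>s\<close>. Measurability of
  \<open>f' s\<close> is inherited from the quotients as their pointwise limit.\<close>

lemma has_real_derivative_integral:
  fixes f f' :: "real \<Rightarrow> 'a \<Rightarrow> real"
  assumes \<delta>: "\<delta> > 0"
    and int: "\<And>t. \<bar>t - s\<bar> < \<delta> \<Longrightarrow> integrable M (f t)"
    and der: "\<And>t y. \<bar>t - s\<bar> < \<delta> \<Longrightarrow> y \<in> space M \<Longrightarrow>
        ((\<lambda>t. f t y) has_real_derivative f' t y) (at t)"
    and bound: "\<And>t y. \<bar>t - s\<bar> < \<delta> \<Longrightarrow> y \<in> space M \<Longrightarrow> \<bar>f' t y\<bar> \<le> w y"
    and w: "integrable M w"
  shows "((\<lambda>t. \<integral>y. f t y \<partial>M) has_real_derivative (\<integral>y. f' s y \<partial>M)) (at s)"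
proof -
  let ?B = "{s - \<delta> <..< s + \<delta>}"
  have s: "s \<in> ?B" using \<delta> by auto
  have B: "t \<in> ?B \<longleftrightarrow> \<bar>t - s\<bar> < \<delta>" for t by auto
  have "((\<lambda>t. ((\<integral>y. f t y \<partial>M) - (\<integral>y. f s y \<partial>M)) / (t - s)) \<longlongrightarrow> (\<integral>y. f' s y \<partial>M)) (at s within ?B)"
    unfolding tendsto_at_iff_sequentially comp_def
  proof (intro allI impI)
    fix X :: "nat \<Rightarrow> real"
    assume X: "\<forall>i. X i \<in> ?B - {s}" and lim: "X \<longlonglongrightarrow> s"
    define q where "q i y = (f (X i) y - f s y) / (X i - s)" for i y
    have X1: "\<bar>X i - s\<bar> < \<delta>" "X i \<noteq> s" for i using X B by blast+
    have intq: "integrable M (q i)" for i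
      unfolding q_def using int[OF X1(1)] int[of s] \<delta> by auto
    have qlim: "(\<lambda>i. q i y) \<longlonglongrightarrow> f' s y" if "y \<in> space M" for y
    proof -
      have "((\<lambda>t. (f t y - f s y) / (t - s)) \<longlongrightarrow> f' s y) (at s)"
        using der[of s y] \<delta> that by (simp add: has_field_derivative_iff)
      then show ?thesis unfolding q_def tendsto_at_iff_sequentially comp_def
        using X1 lim by auto
    qed
    have qb: "\<bar>q i y\<bar> \<le> w y" if y: "y \<in> space M" for i y
    proof -
      have "norm (f (X i) y - f s y) \<le> w y * norm (X i - s)"
      proof (rule field_differentiable_bound[where S="?B"])
        fix t assume t: "t \<in> ?B"
        then show "((\<lambda>t. f t y) has_field_derivative f' t y) (at t within ?B)"
          using der[OF _ y] B by (blast intro: has_field_derivative_at_within)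
        show "norm (f' t y) \<le> w y" using bound[OF _ y] B t by simp
      qed (use X s in auto)
      then show ?thesis using X1[of i] by (simp add: q_def field_simps)
    qed
    have "(\<lambda>i. \<integral>y. q i y \<partial>M) \<longlonglongrightarrow> (\<integral>y. f' s y \<partial>M)"
    proof (rule integral_dominated_convergence[OF _ _ w])
      show "f' s \<in> borel_measurable M"
        by (rule borel_measurable_LIMSEQ_metric[OF _ qlim]) (use intq in auto)
      show "q i \<in> borel_measurable M" for i using intq by auto
    qed (use qlim qb in auto)
    moreover have "(\<integral>y. q i y \<partial>M) = ((\<integral>y. f (X i) y \<partial>M) - (\<integral>y. f s y \<partial>M)) / (X i - s)" for i
      unfolding q_def using int[OF X1(1)] int[of s] \<delta> by simp
    ultimately show "(\<lambda>i. ((\<integral>y. f (X i) y \<partial>M) - (\<integral>y. f s y \<partial>M)) / (X i - s)) \<longlonglongrightarrow> (\<integral>y. f' s y \<partial>M)"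
      by simp
  qed
  then show ?thesis
    using s by (simp add: has_field_derivative_iff at_within_open[of s ?B])
qed

lemma integral_lborel_affine:
  fixes f :: "'a::euclidean_space \<Rightarrow> real"
  assumes [measurable]: "f \<in> borel_measurable borel" and c: "c \<noteq> 0"
  shows "(\<integral>y. f y \<partial>lborel) = \<bar>c\<bar> ^ DIM('a) * (\<integral>y. f (t + c *\<^sub>R y) \<partial>lborel)"
  by (subst lborel_affine[OF c, of t]) (simp add: integral_density integral_distr)

text \<open>By translation invariance the integral of the shifted function does not depend on the
  shift \<open>t\<close>. Differentiating under the integral at \<open>t = 0\<close> gives the
  claim, with no appeal to Fubini.\<close>

lemma integral_directional_derivative_eq_0:
  fixes F F' :: "'a::euclidean_space \<Rightarrow> real"
  assumes F: "integrable lborel F" and M: "M \<ge> 0"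
    and der: "\<And>y. ((\<lambda>t. F (y + t *\<^sub>R b)) has_real_derivative F' y) (at 0)"
    and bound: "\<And>y. \<bar>F' y\<bar> \<le> M * indicator (cball x R) y"
  shows "(\<integral>y. F' y \<partial>lborel) = 0"
proof -
  have Fm: "F \<in> borel_measurable borel" using F by auto
  have "((\<lambda>t. \<integral>y. F (y + t *\<^sub>R b) \<partial>lborel) has_real_derivative (\<integral>y. F' (y + 0 *\<^sub>R b) \<partial>lborel)) (at 0)"
  \<comment> \<open>Shifts with \<open>t\<close> of absolute value below 1 move points by at most
    \<open>norm b\<close>, so one enlarged ball supports the dominating function for all of
    them.\<close>
  proof (rule has_real_derivative_integral[where \<delta>=1 and w="\<lambda>y. M * indicator (cball x (R + norm b)) y"])
    show "integrable lborel (\<lambda>y. F (y + t *\<^sub>R b))" for t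
      using F
      by (subst (asm) lborel_affine[of 1 "t *\<^sub>R b"])
        (use Fm in \<open>auto simp: density_1 integrable_distr_eq add.commute\<close>)
    show "((\<lambda>t. F (y + t *\<^sub>R b)) has_real_derivative F' (y + t *\<^sub>R b)) (at t)" for t y
      using der[of "y + t *\<^sub>R b"] DERIV_shift[of "\<lambda>t. F (y + t *\<^sub>R b)" "F' (y + t *\<^sub>R b)" 0 t]
      by (simp add: algebra_simps)
    show "\<bar>F' (y + t *\<^sub>R b)\<bar> \<le> M * indicator (cball x (R + norm b)) y" if t: "\<bar>t - 0\<bar> < 1" for t y
    proof (cases "y + t *\<^sub>R b \<in> cball x R")
      case True
      have "dist x y \<le> dist x (y + t *\<^sub>R b) + norm (t *\<^sub>R b)"
        using dist_triangle[of x y "y + t *\<^sub>R b"] by (simp add: dist_norm)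
      also have "norm (t *\<^sub>R b) \<le> norm b" using t by (simp add: mult_left_le_one_le)
      finally have "y \<in> cball x (R + norm b)" using True by simp
      then show ?thesis using bound[of "y + t *\<^sub>R b"] True by simp
    next
      case False
      then have "F' (y + t *\<^sub>R b) = 0" using bound[of "y + t *\<^sub>R b"] by simp
      then show ?thesis using M by simp
    qed
  qed (use emeasure_lborel_cball_finite[of x "R + norm b"] in \<open>auto intro!: integrable_mult_right integrable_real_indicator simp: less_top\<close>)
  moreover have "(\<integral>y. F (y + t *\<^sub>R b) \<partial>lborel) = (\<integral>y. F y \<partial>lborel)" for t
    using integral_lborel_affine[OF Fm, of 1 "t *\<^sub>R b"] by (simp add: add.commute)
  ultimately have "((\<lambda>t. \<integral>y. F y \<partial>lborel) has_real_derivative (\<integral>y. F' y \<partial>lborel)) (at 0)" by simp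
  then show ?thesis using DERIV_const DERIV_unique by blast
qed

text \<open>Squaring removes the kink of the truncation. This makes the zero extension of the
  squared weight differentiable across the sphere.\<close>

lemma max_0_square_has_real_derivative:
  "((\<lambda>z::real. (max 0 z)\<^sup>2) has_real_derivative 2 * max 0 z) (at z)"
proof -
  consider "z > 0" | "z < 0" | "z = 0" by linarith
  then show ?thesis
  proof cases
    case 1
    have "((\<lambda>z::real. z\<^sup>2) has_real_derivative 2 * max 0 z) (at z)"
      using 1 by (auto intro!: derivative_eq_intros)
    then show ?thesis
      by (rule has_field_derivative_transform_within_open[where S="{0<..}"]) (use 1 in auto)
  next
    case 2
    have "((\<lambda>z::real. 0) has_real_derivative 2 * max 0 z) (at z)" using 2 by simp
    then show ?thesis
      by (rule has_field_derivative_transform_within_open[where S="{..<0}"]) (use 2 in auto)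
  next
    case 3
    have "((\<lambda>t::real. ((max 0 t)\<^sup>2 - (max 0 0)\<^sup>2) / (t - 0)) \<longlongrightarrow> 0) (at 0)"
    proof (rule Lim_null_comparison)
      show "\<forall>\<^sub>F t::real in at 0. norm (((max 0 t)\<^sup>2 - (max 0 0)\<^sup>2) / (t - 0)) \<le> \<bar>t\<bar>"
        by (auto simp: max_def power2_eq_square)
    qed (auto intro!: tendsto_eq_intros)
    then show ?thesis using 3 by (simp add: has_field_derivative_iff)
  qed
qed

section \<open>Total differentiability from continuous partial derivatives\<close>

text \<open>The increment is split into moves along one coordinate at a time, and continuity of the
  partial derivatives controls each move. Total differentiability is what makes
  \<open>dir_deriv f u\<close> linear in \<open>u\<close>, as needed for normal directions.\<close>

lemma C1_on_has_derivative:
  fixes f :: "'a::euclidean_space \<Rightarrow> real"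
  assumes D: "open D" and f: "C1_on D f" and y: "y \<in> D"
  shows "(f has_derivative (\<lambda>h. \<Sum>b\<in>Basis. (h \<bullet> b) * dir_deriv f b y)) (at y)"
  unfolding has_derivative_at_alt
proof (intro conjI allI impI)
  show "bounded_linear (\<lambda>h. \<Sum>b\<in>Basis. (h \<bullet> b) * dir_deriv f b y)"
    by (intro bounded_linear_intros)
  fix e :: real assume e: "e > 0"
  \<comment> \<open>The absolute coordinates of an increment add up to at most the dimension times
    its norm; this scaling compensates.\<close>
  define e' where "e' = e / real DIM('a)"
  have e': "e' > 0" using e by (simp add: e'_def)
  have "\<forall>\<^sub>F z in nhds y. \<bar>dir_deriv f b z - dir_deriv f b y\<bar> < e'" if "b \<in> Basis" for b
  proof -
    have "continuous (at y) (dir_deriv f b)"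
      using f that y D by (simp add: C1_on_def continuous_on_eq_continuous_at)
    then have "(dir_deriv f b \<longlongrightarrow> dir_deriv f b y) (nhds y)"
      by (simp add: continuous_at tendsto_nhds_iff)
    from tendstoD[OF this e'] show ?thesis by (simp add: dist_real_def)
  qed
  then have "\<forall>\<^sub>F z in nhds y. \<forall>b\<in>Basis. \<bar>dir_deriv f b z - dir_deriv f b y\<bar> < e'"
    by (simp add: eventually_ball_finite_distrib)
  moreover have "\<forall>\<^sub>F z in nhds y. z \<in> D" using D y by (simp add: eventually_nhds_in_open)
  ultimately have "\<forall>\<^sub>F z in nhds y. z \<in> D \<and> (\<forall>b\<in>Basis. \<bar>dir_deriv f b z - dir_deriv f b y\<bar> < e')"
    by eventually_elim auto
  then obtain d where d: "d > 0" and dD: "\<And>z. dist z y < d \<Longrightarrow> z \<in> D"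
    and dp: "\<And>z b. dist z y < d \<Longrightarrow> b \<in> Basis \<Longrightarrow> \<bar>dir_deriv f b z - dir_deriv f b y\<bar> < e'"
    unfolding eventually_nhds_metric by blast
  have part: "((\<lambda>t. f (z + t *\<^sub>R b)) has_real_derivative dir_deriv f b (z + t *\<^sub>R b)) (at t)"
    if "z + t *\<^sub>R b \<in> D" "b \<in> Basis" for z b t
  proof -
    have "(\<lambda>s. f ((z + t *\<^sub>R b) + s *\<^sub>R b)) differentiable (at 0)"
      using f that by (simp add: C1_on_def)
    then have "((\<lambda>s. f ((z + t *\<^sub>R b) + s *\<^sub>R b)) has_real_derivative dir_deriv f b (z + t *\<^sub>R b)) (at 0)"
      unfolding dir_deriv_def by (metis DERIV_deriv_iff_real_differentiable)
    then show ?thesis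
      using DERIV_shift[of "\<lambda>t. f (z + t *\<^sub>R b)" "dir_deriv f b (z + t *\<^sub>R b)" 0 t]
      by (simp add: algebra_simps)
  qed
  \<comment> \<open>Telescoping: induction on the set \<open>B\<close> of coordinates moved so
    far.\<close>
  have key: "\<bar>f (y + (\<Sum>b\<in>B. (h \<bullet> b) *\<^sub>R b)) - f y - (\<Sum>b\<in>B. (h \<bullet> b) * dir_deriv f b y)\<bar> \<le> e' * (\<Sum>b\<in>B. \<bar>h \<bullet> b\<bar>)"
    if h: "norm h < d" and "B \<subseteq> Basis" for B h
  proof -
    have "finite B" using that finite_subset finite_Basis by blast
    then show ?thesis using that(2)
    proof (induction B)
      case (insert c B)
      define z where "z = y + (\<Sum>b\<in>B. (h \<bullet> b) *\<^sub>R b)"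
      have c: "c \<in> Basis" "c \<notin> B" "B \<subseteq> Basis" using insert by auto
      \<comment> \<open>Relative to \<open>y\<close>, the intermediate points have coordinates
        dominated by those of \<open>h\<close>, so they stay where \<open>dp\<close>
        applies.\<close>
      have near: "dist (z + t *\<^sub>R c) y < d" if t: "t \<in> closed_segment 0 (h \<bullet> c)" for t
      proof -
        have tb: "\<bar>t\<bar> \<le> \<bar>h \<bullet> c\<bar>" using t by (auto simp: closed_segment_eq_real_ivl split: if_splits)
        have "z + t *\<^sub>R c - y = (\<Sum>b\<in>Basis. (if b \<in> B then h \<bullet> b else if b = c then t else 0) *\<^sub>R b)"
        proof -
          have "(\<Sum>b\<in>Basis. (if b \<in> B then h \<bullet> b else if b = c then t else 0) *\<^sub>R b)
             = (\<Sum>b\<in>insert c B. (if b \<in> B then h \<bullet> b else if b = c then t else 0) *\<^sub>R b)"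
            using c by (intro sum.mono_neutral_right) auto
          also have "\<dots> = t *\<^sub>R c + (\<Sum>b\<in>B. (h \<bullet> b) *\<^sub>R b)"
            using c insert.hyps by (auto intro!: sum.cong)
          finally show ?thesis by (simp add: z_def)
        qed
        then have "norm (z + t *\<^sub>R c - y) \<le> norm h"
          using tb by (intro norm_le_componentwise) (auto simp: inner_sum_left_Basis)
        then show ?thesis using h by (simp add: dist_norm)
      qed
      \<comment> \<open>Subtracting the linear function of slope \<open>dir_deriv f c y\<close>
        leaves a function whose derivative is the variation of the partial derivative, which is at
        most \<open>e'\<close>.\<close>
      have "norm ((f (z + (h \<bullet> c) *\<^sub>R c) - (h \<bullet> c) * dir_deriv f c y) - (f (z + 0 *\<^sub>R c) - 0 * dir_deriv f c y))
         \<le> e' * norm (h \<bullet> c - 0)"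
      proof (rule field_differentiable_bound[where S="closed_segment 0 (h \<bullet> c)"
            and f'="\<lambda>t. dir_deriv f c (z + t *\<^sub>R c) - dir_deriv f c y"])
        fix t assume t: "t \<in> closed_segment 0 (h \<bullet> c)"
        show "((\<lambda>t. f (z + t *\<^sub>R c) - t * dir_deriv f c y) has_field_derivative
           dir_deriv f c (z + t *\<^sub>R c) - dir_deriv f c y) (at t within closed_segment 0 (h \<bullet> c))"
          using part[OF dD[OF near[OF t]] c(1)]
          by (intro has_field_derivative_at_within[OF DERIV_diff] DERIV_cmult_Id[of "dir_deriv f c y", unfolded mult.commute[of "dir_deriv f c y"]])
        show "norm (dir_deriv f c (z + t *\<^sub>R c) - dir_deriv f c y) \<le> e'"
          using dp[OF near[OF t] c(1)] by simp
      qed simp_all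
      moreover have "y + (\<Sum>b\<in>insert c B. (h \<bullet> b) *\<^sub>R b) = z + (h \<bullet> c) *\<^sub>R c"
        using c insert.hyps by (simp add: z_def algebra_simps)
      ultimately show ?case using insert.IH[OF c(3)] c insert.hyps
        by (simp add: z_def distrib_left add_ac)
    qed simp
  qed
  show "\<exists>d>0. \<forall>y'. norm (y' - y) < d \<longrightarrow> norm (f y' - f y - (\<Sum>b\<in>Basis. ((y' - y) \<bullet> b) * dir_deriv f b y)) \<le> e * norm (y' - y)"
  proof (intro exI conjI allI impI)
    fix y' assume y': "norm (y' - y) < d"
    have "norm (f y' - f y - (\<Sum>b\<in>Basis. ((y' - y) \<bullet> b) * dir_deriv f b y)) \<le> e' * (\<Sum>b\<in>Basis. \<bar>(y' - y) \<bullet> b\<bar>)"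
      using key[OF y' order_refl] by (simp add: euclidean_representation)
    also have "\<dots> \<le> e' * (\<Sum>b\<in>(Basis::'a set). norm (y' - y))"
      using e' by (intro mult_left_mono sum_mono Basis_le_norm) auto
    also have "\<dots> = e * norm (y' - y)" by (simp add: e'_def)
    finally show "norm (f y' - f y - (\<Sum>b\<in>Basis. ((y' - y) \<bullet> b) * dir_deriv f b y)) \<le> e * norm (y' - y)" .
  qed (rule d)
qed

subsection \<open>Polar coordinates by cones\<close>

definition ball_integral :: "('a::euclidean_space \<Rightarrow> real) \<Rightarrow> 'a \<Rightarrow> real \<Rightarrow> real" where
  "ball_integral f x s = (LINT y:ball x s|lborel. f y)"

text \<open>Up to the factor \<open>m\<close>, the integral of \<open>\<omega> \<mapsto> f (x + s \<omega>)\<close> over the unit sphere.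
  Unlike a sphere integral it makes sense, and is differentiable, at \<open>s = 0\<close> as well.\<close>
definition cone_integral :: "('a::euclidean_space \<Rightarrow> real) \<Rightarrow> 'a \<Rightarrow> real \<Rightarrow> real" where
  "cone_integral f x s = (LINT y:ball 0 1|lborel. f (x + s *\<^sub>R sgn y))"

lemma ball_integral_0 [simp]: "ball_integral f x 0 = 0"
  by (simp add: ball_integral_def set_lebesgue_integral_def)

lemma borel_measurable_translate_sgn [measurable]:
  "(\<lambda>y. x + s *\<^sub>R sgn (y - z)) \<in> borel_measurable (borel :: 'a::euclidean_space measure)"
  unfolding sgn_div_norm by measurable

lemma set_integrable_cball_continuous:
  fixes f :: "'a::euclidean_space \<Rightarrow> real"
  assumes "continuous_on (cball x R) f" "A \<in> sets borel" "A \<subseteq> cball x R"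
  shows "set_integrable lborel A f"
proof (rule set_integrable_subset)
  show "set_integrable lborel (cball x R) f"
    unfolding set_integrable_def by (intro borel_integrable_compact assms) simp
qed (use assms in auto)

text \<open>Continuity of \<open>f\<close> is given only on the closed ball, so the indicator of
  that ball is multiplied in first; it equals 1 at every point \<open>x + s *\<^sub>R sgn w\<close>
  and drops out again.\<close>

lemma borel_measurable_continuous_sgn:
  fixes f :: "'a::euclidean_space \<Rightarrow> real"
  assumes "continuous_on (cball x R) f" "\<bar>s\<bar> \<le> R"
  shows "(\<lambda>y. f (x + s *\<^sub>R sgn (y - z))) \<in> borel_measurable borel"
proof -
  have "(\<lambda>y. indicator (cball x R) y *\<^sub>R f y) \<in> borel_measurable borel"
    by (intro borel_measurable_continuous_on_indicator assms) simp
  then have "(\<lambda>y. indicator (cball x R) (x + s *\<^sub>R sgn (y - z)) *\<^sub>R f (x + s *\<^sub>R sgn (y - z))) \<in> borel_measurable borel"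
    by (rule measurable_compose[OF borel_measurable_translate_sgn])
  moreover have "x + s *\<^sub>R sgn w \<in> cball x R" for w
    using assms(2) by (auto simp: norm_sgn dist_norm)
  ultimately show ?thesis by simp
qed

lemma continuous_on_cball_bounded:
  fixes f :: "'a::euclidean_space \<Rightarrow> real"
  assumes "continuous_on (cball x R) f"
  obtains B where "B \<ge> 0" "\<And>y. y \<in> cball x R \<Longrightarrow> \<bar>f y\<bar> \<le> B"
proof -
  have "compact (f ` cball x R)" using assms by (intro compact_continuous_image) auto
  then obtain B where B: "\<And>y. y \<in> cball x R \<Longrightarrow> \<bar>f y\<bar> \<le> B"
    by (force dest: compact_imp_bounded simp: bounded_iff)
  show ?thesis by (rule that[of "max 0 B"]) (use B in fastforce)+
qed

lemma set_integrable_continuous_sgn: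
  fixes f :: "'a::euclidean_space \<Rightarrow> real"
  assumes "continuous_on (cball x R) f" "\<bar>s\<bar> \<le> R"
  shows "set_integrable lborel (ball c r) (\<lambda>y. f (x + s *\<^sub>R sgn (y - z)))"
proof -
  obtain B where B: "\<And>y. y \<in> cball x R \<Longrightarrow> \<bar>f y\<bar> \<le> B"
    using continuous_on_cball_bounded[OF assms(1)] by blast
  have "x + s *\<^sub>R sgn w \<in> cball x R" for w
    using assms(2) by (auto simp: norm_sgn dist_norm)
  then show ?thesis unfolding set_integrable_def
    using emeasure_lborel_ball_finite[of c r] B borel_measurable_continuous_sgn[OF assms]
    by (intro integrableI_bounded_set_indicator[where B=B]) auto
qed

text \<open>The integrand depends on the direction alone, so dilating to the unit ball changes
  nothing but the volume element.\<close>

lemma ball_integral_sgn: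
  fixes h :: "'a::euclidean_space \<Rightarrow> real"
  assumes "s > 0" and h: "(\<lambda>y. h (sgn (y - x))) \<in> borel_measurable borel"
  shows "(LINT y:ball x s|lborel. h (sgn (y - x))) = s ^ DIM('a) * (LINT y:ball 0 1|lborel. h (sgn y))"
proof -
  have "(LINT y:ball x s|lborel. h (sgn (y - x))) =
     \<bar>s\<bar> ^ DIM('a) * (\<integral>y. indicator (ball x s) (x + s *\<^sub>R y) *\<^sub>R h (sgn (x + s *\<^sub>R y - x)) \<partial>lborel)"
    unfolding set_lebesgue_integral_def using h assms
    by (intro integral_lborel_affine borel_measurable_scaleR borel_measurable_indicator) auto
  moreover have "indicator (ball x s) (x + s *\<^sub>R y) = (indicator (ball 0 1) y :: real)" for y
    using assms by (auto simp: indicator_def dist_norm)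
  ultimately show ?thesis using assms
    by (simp add: set_lebesgue_integral_def sgn_scaleR)
qed

lemma ball_integral_diff:
  assumes "set_integrable lborel (ball x b) f" "a \<le> b"
  shows "ball_integral f x b - ball_integral f x a = (LINT y:ball x b - ball x a|lborel. f y)"
proof -
  have sub: "ball x a \<subseteq> ball x b" using assms by auto
  then have "ball_integral f x b = (LINT y:ball x a \<union> (ball x b - ball x a)|lborel. f y)"
    unfolding ball_integral_def by (simp add: Un_absorb1)
  also have "\<dots> = ball_integral f x a + (LINT y:ball x b - ball x a|lborel. f y)"
    unfolding ball_integral_def
    by (intro set_integral_Un set_integrable_subset[OF assms(1)]) (use sub in auto)
  finally show ?thesis by simp
qed

lemma ball_integral_annulus_approx:
  fixes f :: "'a::euclidean_space \<Rightarrow> real"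
  assumes cont: "continuous_on (cball x R) f"
    and ab: "0 < a" "a \<le> b" "b \<le> R" and s: "0 < s" "s \<le> R"
    and close: "\<And>y. a \<le> dist x y \<Longrightarrow> dist x y < b \<Longrightarrow> \<bar>f y - f (x + s *\<^sub>R sgn (y - x))\<bar> \<le> \<epsilon>"
  shows "\<bar>ball_integral f x b - ball_integral f x a - (b ^ DIM('a) - a ^ DIM('a)) * cone_integral f x s\<bar>
     \<le> \<epsilon> * (unit_ball_vol DIM('a) * (b ^ DIM('a) - a ^ DIM('a)))"
proof -
  let ?g = "\<lambda>y. f (x + s *\<^sub>R sgn (y - x))" and ?S = "ball x b - ball x a"
  have fint: "set_integrable lborel (ball x b) f"
    using ab by (intro set_integrable_cball_continuous[OF cont]) auto
  have gint: "set_integrable lborel (ball x b) ?g"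
    using s by (intro set_integrable_continuous_sgn[OF cont]) auto
  have gm: "(\<lambda>y. f (x + s *\<^sub>R sgn (y - x))) \<in> borel_measurable borel"
    using s by (intro borel_measurable_continuous_sgn[OF cont]) auto
  have "ball_integral ?g x t = t ^ DIM('a) * cone_integral f x s" if "t > 0" for t
    unfolding ball_integral_def cone_integral_def
    by (rule ball_integral_sgn[where h="\<lambda>y. f (x + s *\<^sub>R y)", OF that gm])
  then have g: "(LINT y:?S|lborel. ?g y) = (b ^ DIM('a) - a ^ DIM('a)) * cone_integral f x s"
    using ball_integral_diff[OF gint ab(2)] ab by (simp add: algebra_simps)
  have sub: "set_integrable lborel ?S f" "set_integrable lborel ?S ?g"
    by (auto intro: set_integrable_subset[OF fint] set_integrable_subset[OF gint])
  have vol: "measure lborel ?S = unit_ball_vol DIM('a) * (b ^ DIM('a) - a ^ DIM('a))"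
  proof -
    have "measure lborel ?S = measure lborel (ball x b) - measure lborel (ball x a)"
      using ab emeasure_lborel_ball_finite[of x b] by (intro measure_Diff) (auto simp: less_top)
    then show ?thesis using ab by (simp add: content_ball algebra_simps)
  qed
  have cint: "set_integrable lborel ?S (\<lambda>y. \<epsilon>)"
    unfolding set_integrable_def
    using emeasure_lborel_ball_finite[of x b] emeasure_mono[of ?S "ball x b" lborel]
    by (intro integrable_scaleR_left integrable_real_indicator) (auto simp: less_top top_unique)
  have "\<bar>LINT y:?S|lborel. (f y - ?g y)\<bar> \<le> (LINT y:?S|lborel. \<bar>f y - ?g y\<bar>)"
    using set_integral_norm_bound[OF set_integral_diff(1)[OF sub]] by simp
  also have "\<dots> \<le> (LINT y:?S|lborel. \<epsilon>)"
    using set_integrable_abs[OF set_integral_diff(1)[OF sub]] cint close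
    by (intro set_integral_mono) auto
  also have "\<dots> = \<epsilon> * measure lborel ?S"
    by (simp add: set_lebesgue_integral_def)
  finally show ?thesis
    unfolding set_integral_diff(2)[OF sub] g vol ball_integral_diff[OF fint ab(2), symmetric] .
qed

text \<open>Polar integration in differential form: by uniform continuity, freezing \<open>f\<close>
  along rays becomes exact in the limit of thin shells.\<close>

lemma ball_integral_has_derivative:
  fixes f :: "'a::euclidean_space \<Rightarrow> real"
  assumes cont: "continuous_on (cball x R) f" and s: "0 < s" "s < R"
  shows "(ball_integral f x has_real_derivative real DIM('a) * s ^ (DIM('a) - 1) * cone_integral f x s) (at s)"
proof -
  let ?m = "DIM('a)"
  let ?V = "unit_ball_vol (real ?m)"
  \<comment> \<open>The difference quotient factors as
    \<open>q t * (cone_integral f x s + e t)\<close>. The factor \<open>q\<close> tends to the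
    derivative of the power, so it remains to show that \<open>e\<close> tends to 0.\<close>
  define q where "q t = (t ^ ?m - s ^ ?m) / (t - s)" for t
  define e where "e t = (ball_integral f x t - ball_integral f x s) / (t ^ ?m - s ^ ?m) - cone_integral f x s" for t
  have V: "?V > 0" by simp
  have pow: "a ^ ?m < b ^ ?m" if "0 < a" "a < b" for a b :: real
    using that by (intro power_strict_mono) auto
  have "(e \<longlongrightarrow> 0) (at s)"
  proof (rule tendstoI)
    fix \<epsilon> :: real assume \<epsilon>: "\<epsilon> > 0"
    \<comment> \<open>The factor 2 turns the weak shell estimate into a strict bound by
      \<open>\<epsilon>\<close>.\<close>
    define \<epsilon>' where "\<epsilon>' = \<epsilon> / (2 * ?V)"
    have \<epsilon>': "\<epsilon>' > 0" using \<epsilon> V by (simp add: \<epsilon>'_def)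
    have "uniformly_continuous_on (cball x R) f"
      using cont by (intro compact_uniformly_continuous) auto
    then obtain d where d: "d > 0"
      and du: "\<And>y z. y \<in> cball x R \<Longrightarrow> z \<in> cball x R \<Longrightarrow> dist z y < d \<Longrightarrow> dist (f z) (f y) < \<epsilon>'"
      using \<epsilon>' unfolding uniformly_continuous_on_def by blast
    have "\<forall>\<^sub>F t in at s. t \<in> {0<..<R} \<inter> {s - d<..<s + d}"
      using s d by (intro eventually_at_in_open') auto
    moreover have "\<forall>\<^sub>F t in at s. t \<noteq> s" by (simp add: eventually_neq_at_within)
    ultimately show "\<forall>\<^sub>F t in at s. dist (e t) 0 < \<epsilon>"
    proof eventually_elim
      case (elim t)
      then have t: "0 < t" "t < R" "\<bar>t - s\<bar> < d" "t \<noteq> s" by auto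
      have close: "\<bar>f y - f (x + s *\<^sub>R sgn (y - x))\<bar> \<le> \<epsilon>'"
        if y: "min s t \<le> dist x y" "dist x y < max s t" for y
      proof -
        have "y \<noteq> x" using y s t by auto
        then have "y - x = norm (y - x) *\<^sub>R sgn (y - x)"
          by (simp add: sgn_div_norm)
        then have "y - (x + s *\<^sub>R sgn (y - x)) = (norm (y - x) - s) *\<^sub>R sgn (y - x)"
          by (metis scaleR_diff_left diff_diff_eq)
        then have "dist y (x + s *\<^sub>R sgn (y - x)) = \<bar>dist x y - s\<bar>"
          using \<open>y \<noteq> x\<close> by (simp add: dist_norm norm_sgn norm_minus_commute)
        also have "\<dots> < d" using y t by linarith
        finally have "dist (f y) (f (x + s *\<^sub>R sgn (y - x))) < \<epsilon>'"
          using y s t by (intro du) (auto simp: dist_norm norm_sgn)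
        then show ?thesis by (simp add: dist_real_def)
      qed
      have "\<bar>e t\<bar> \<le> \<epsilon>' * ?V"
      proof (cases "s < t")
        case True
        have p: "t ^ ?m - s ^ ?m > 0" using pow[OF s(1) True] by simp
        have "\<bar>ball_integral f x t - ball_integral f x s - (t ^ ?m - s ^ ?m) * cone_integral f x s\<bar> \<le> \<epsilon>' * (?V * (t ^ ?m - s ^ ?m))"
          using True s t close by (intro ball_integral_annulus_approx[OF cont]) auto
        moreover have "ball_integral f x t - ball_integral f x s - (t ^ ?m - s ^ ?m) * cone_integral f x s = e t * (t ^ ?m - s ^ ?m)"
          using p by (simp add: e_def field_simps)
        ultimately show ?thesis using p by (simp add: abs_mult flip: mult.assoc)
      next
        case False
        then have ts: "t < s" using t by simp
        have p: "s ^ ?m - t ^ ?m > 0" using pow[OF t(1) ts] by simp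
        have "\<bar>ball_integral f x s - ball_integral f x t - (s ^ ?m - t ^ ?m) * cone_integral f x s\<bar> \<le> \<epsilon>' * (?V * (s ^ ?m - t ^ ?m))"
          using ts s t close by (intro ball_integral_annulus_approx[OF cont]) auto
        moreover have "ball_integral f x s - ball_integral f x t - (s ^ ?m - t ^ ?m) * cone_integral f x s = e t * (s ^ ?m - t ^ ?m)"
        proof -
          have "(A s' - A t') - p * c = ((A t' - A s') / (- p) - c) * p" if "p > 0" for A and s' t' p c :: real
            using that by (simp add: field_simps)
          from this[OF p, of "ball_integral f x"] show ?thesis by (simp add: e_def)
        qed
        ultimately show ?thesis using p by (simp add: abs_mult flip: mult.assoc)
      qed
      also have "\<dots> < \<epsilon>" using \<epsilon> V by (simp add: \<epsilon>'_def)
      finally show ?case by simp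
    qed
  qed
  moreover have "(q \<longlongrightarrow> real ?m * s ^ (?m - 1)) (at s)"
    using DERIV_pow[of ?m s] unfolding has_field_derivative_iff q_def by simp
  ultimately have "((\<lambda>t. q t * (cone_integral f x s + e t)) \<longlongrightarrow> real ?m * s ^ (?m - 1) * (cone_integral f x s + 0)) (at s)"
    by (intro tendsto_intros)
  moreover have "\<forall>\<^sub>F t in at s. q t * (cone_integral f x s + e t) = (ball_integral f x t - ball_integral f x s) / (t - s)"
  proof -
    have "\<forall>\<^sub>F t in at s. t \<in> {0<..}" using s by (intro eventually_at_in_open') auto
    moreover have "\<forall>\<^sub>F t in at s. t \<noteq> s" by (simp add: eventually_neq_at_within)
    ultimately show ?thesis
    proof eventually_elim
      case (elim t)
      then have "t ^ ?m \<noteq> s ^ ?m" using pow[of t s] pow[of s t] s by (cases "t < s") auto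
      then show ?case using elim by (simp add: q_def e_def)
    qed
  qed
  ultimately show ?thesis
    unfolding has_field_derivative_iff by (simp add: tendsto_cong)
qed

subsection \<open>The divergence theorem on a ball\<close>

lemma C1_on_has_real_derivative_line:
  fixes f :: "'a::euclidean_space \<Rightarrow> real"
  assumes D: "open D" and f: "C1_on D f" and y: "y + t *\<^sub>R u \<in> D"
  shows "((\<lambda>t. f (y + t *\<^sub>R u)) has_real_derivative
           (\<Sum>b\<in>Basis. (u \<bullet> b) * dir_deriv f b (y + t *\<^sub>R u))) (at t)"
proof -
  have "((\<lambda>t. y + t *\<^sub>R u) has_vector_derivative u) (at t)"
    by (auto intro!: derivative_eq_intros simp: has_vector_derivative_def)
  from vector_derivative_diff_chain_within[OF this has_derivative_at_withinI[OF C1_on_has_derivative[OF D f y]]]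
  show ?thesis
    by (simp add: o_def has_real_derivative_iff_has_vector_derivative)
qed

lemma C1_on_dir_deriv:
  fixes f :: "'a::euclidean_space \<Rightarrow> real"
  assumes D: "open D" and f: "C1_on D f" and y: "y \<in> D"
  shows "dir_deriv f u y = (\<Sum>b\<in>Basis. (u \<bullet> b) * dir_deriv f b y)"
  using C1_on_has_real_derivative_line[of D f y 0 u] assms
  by (simp add: dir_deriv_def[of f u] DERIV_imp_deriv)

lemma ball_integral_sum:
  assumes "\<And>i. i \<in> I \<Longrightarrow> set_integrable lborel (ball x r) (f i)"
  shows "ball_integral (\<lambda>y. \<Sum>i\<in>I. f i y) x r = (\<Sum>i\<in>I. ball_integral (f i) x r)"
  using assms unfolding ball_integral_def set_lebesgue_integral_def set_integrable_def
  by (simp add: sum_distrib_left)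

text \<open>The weight vanishes to second order on the sphere, so the extension of the integrand by zero is
  differentiable everywhere and no boundary term appears.\<close>
lemma ball_integral_by_parts:
  fixes g :: "'a::euclidean_space \<Rightarrow> real"
  assumes D: "open D" and g: "C1_on D g" and sub: "cball x R \<subseteq> D" and R: "R > 0" and b: "b \<in> Basis"
  shows "ball_integral (\<lambda>y. (R\<^sup>2 - (norm (y - x))\<^sup>2)\<^sup>2 * dir_deriv g b y) x R =
     4 * ball_integral (\<lambda>y. (R\<^sup>2 - (norm (y - x))\<^sup>2) * (((y - x) \<bullet> b) * g y)) x R"
proof -
  define p where "p y = R\<^sup>2 - (norm (y - x))\<^sup>2" for y
  define F where "F y = (max 0 (p y))\<^sup>2 * g y" for y
  define F' where "F' y = (max 0 (p y))\<^sup>2 * dir_deriv g b y - 4 * (max 0 (p y) * (((y - x) \<bullet> b) * g y))" for y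
  have p_neg: "p y \<le> 0 \<longleftrightarrow> y \<notin> ball x R" for y
    using R abs_le_square_iff[of R "norm (y - x)"] by (simp add: p_def dist_norm norm_minus_commute not_less)
  have contg: "continuous_on (cball x R) g" and contg': "continuous_on (cball x R) (dir_deriv g b)"
    using g b sub unfolding C1_on_def by (meson continuous_on_subset)+
  have contp: "continuous_on S p" for S unfolding p_def by (intro continuous_intros)
  have contF: "continuous_on (cball x R) F" and contF': "continuous_on (cball x R) F'"
    unfolding F_def F'_def by (intro continuous_intros contg contg' contp)+
  have pder: "((\<lambda>t. p (y + t *\<^sub>R b)) has_real_derivative - 2 * ((y - x) \<bullet> b)) (at 0)" for y
  proof -
    have "p (y + t *\<^sub>R b) = R\<^sup>2 - ((norm (y - x))\<^sup>2 + 2 * t * ((y - x) \<bullet> b) + t\<^sup>2 * (b \<bullet> b))" for t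
      unfolding p_def power2_norm_eq_inner
      by (simp add: inner_simps inner_commute algebra_simps power2_eq_square)
    then show ?thesis by (auto intro!: derivative_eq_intros)
  qed
  have F_out: "F z = 0" if "z \<notin> cball x R" for z
    using p_neg[of z] that by (auto simp: F_def max_def)
  have F'_out: "F' z = 0" if "z \<notin> ball x R" for z
    using p_neg[of z] that by (auto simp: F'_def max_def)
  \<comment> \<open>The cases are split at \<open>D\<close> rather than at the ball. Inside
    \<open>D\<close>, and so also on the sphere, the product rule applies; outside \<open>D\<close>
    nothing is known about \<open>g\<close>, but \<open>F\<close> vanishes in a
    neighbourhood.\<close>
  have der: "((\<lambda>t. F (y + t *\<^sub>R b)) has_real_derivative F' y) (at 0)" for y
  proof (cases "y \<in> D")
    case True
    have 1: "((\<lambda>t. g (y + t *\<^sub>R b)) has_real_derivative dir_deriv g b y) (at 0)"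
      using C1_on_has_real_derivative_line[OF D g, of y 0 b] C1_on_dir_deriv[OF D g True, of b] True by simp
    have 2: "((\<lambda>t. (max 0 (p (y + t *\<^sub>R b)))\<^sup>2) has_real_derivative 2 * max 0 (p y) * (- 2 * ((y - x) \<bullet> b))) (at 0)"
      by (rule DERIV_chain2[OF _ pder[of y], of "\<lambda>z. (max 0 z)\<^sup>2"])
        (simp add: max_0_square_has_real_derivative)
    show ?thesis unfolding F_def F'_def
      using DERIV_mult[OF 2 1] by (simp add: algebra_simps)
  next
    case False
    then have out: "y \<in> - cball x R" using sub by auto
    have "F' y = 0" using F'_out out by auto
    have "open ((\<lambda>t::real. y + t *\<^sub>R b) -` (- cball x R))"
      by (intro open_vimage continuous_intros) auto
    then have "((\<lambda>t. F (y + t *\<^sub>R b)) has_real_derivative 0) (at 0)"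
      by (rule has_field_derivative_transform_within_open[OF DERIV_const[of 0]])
        (use out F_out in auto)
    then show ?thesis using \<open>F' y = 0\<close> by simp
  qed
  obtain M where M: "M \<ge> 0" "\<And>y. y \<in> cball x R \<Longrightarrow> \<bar>F' y\<bar> \<le> M"
    using continuous_on_cball_bounded[OF contF'] by blast
  have "(\<integral>y. F' y \<partial>lborel) = 0"
  proof (rule integral_directional_derivative_eq_0[OF _ M(1) der])
    have "(\<lambda>y. indicator (cball x R) y *\<^sub>R F y) = F"
      using F_out by (intro ext) (auto simp: indicator_def)
    then show "integrable lborel F"
      using borel_integrable_compact[OF _ contF] by simp
    show "\<bar>F' y\<bar> \<le> M * indicator (cball x R) y" for y
      using F'_out[of y] M(2)[of y] by (cases "y \<in> cball x R") auto
  qed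
  moreover have "F' y = indicator (ball x R) y *\<^sub>R ((p y)\<^sup>2 * dir_deriv g b y - 4 * (p y * (((y - x) \<bullet> b) * g y)))" for y
    using p_neg[of y] by (auto simp: F'_def max_def indicator_def)
  ultimately have "(LINT y:ball x R|lborel. (p y)\<^sup>2 * dir_deriv g b y - 4 * (p y * (((y - x) \<bullet> b) * g y))) = 0"
    by (simp add: set_lebesgue_integral_def)
  moreover have "set_integrable lborel (ball x R) (\<lambda>y. (p y)\<^sup>2 * dir_deriv g b y)"
    by (rule set_integrable_cball_continuous[where x=x and R=R]) (intro continuous_intros contg' contp | auto)+
  moreover have "set_integrable lborel (ball x R) (\<lambda>y. p y * (((y - x) \<bullet> b) * g y))"
    by (rule set_integrable_cball_continuous[where x=x and R=R]) (intro continuous_intros contg contp | auto)+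
  ultimately show ?thesis
    by (simp add: ball_integral_def flip: p_def)
qed

text \<open>On the sphere of radius \<open>s\<close> the weight is the constant \<open>h s\<close>
  and comes out of the cone integral. Equality of the integrands is only almost everywhere: at the
  origin \<open>sgn\<close> is 0 and the weight is \<open>h 0\<close>.\<close>

lemma ball_integral_radial_has_derivative:
  fixes f :: "'a::euclidean_space \<Rightarrow> real"
  assumes cont: "continuous_on (cball x R) f" and h: "continuous_on UNIV h" and s: "0 < s" "s < R"
  shows "(ball_integral (\<lambda>y. h (norm (y - x)) * f y) x has_real_derivative
     h s * (real DIM('a) * s ^ (DIM('a) - 1) * cone_integral f x s)) (at s)"
proof -
  have hc: "continuous_on (cball x R) (\<lambda>y. h (norm (y - x)) * f y)"
    by (intro continuous_intros cont continuous_on_compose2[OF h]) auto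
  have "cone_integral (\<lambda>y. h (norm (y - x)) * f y) x s = (\<integral>y. h s * (indicator (ball 0 1) y *\<^sub>R f (x + s *\<^sub>R sgn y)) \<partial>lborel)"
    unfolding cone_integral_def set_lebesgue_integral_def
  proof (rule integral_cong_AE)
    show "(\<lambda>y. indicator (ball 0 1) y *\<^sub>R (h (norm (x + s *\<^sub>R sgn y - x)) * f (x + s *\<^sub>R sgn y))) \<in> borel_measurable lborel"
      using borel_measurable_continuous_sgn[OF hc, of s 0] s
      by (intro borel_measurable_scaleR borel_measurable_indicator) auto
    show "(\<lambda>y. h s * (indicator (ball 0 1) y *\<^sub>R f (x + s *\<^sub>R sgn y))) \<in> borel_measurable lborel"
      using borel_measurable_continuous_sgn[OF cont, of s 0] s
      by (intro borel_measurable_times borel_measurable_scaleR borel_measurable_indicator) auto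
    show "AE y in lborel. indicator (ball 0 1) y *\<^sub>R (h (norm (x + s *\<^sub>R sgn y - x)) * f (x + s *\<^sub>R sgn y)) = h s * (indicator (ball 0 1) y *\<^sub>R f (x + s *\<^sub>R sgn y))"
      using AE_lborel_singleton[of "0::'a"] by eventually_elim (use s in \<open>simp add: norm_sgn\<close>)
  qed
  then have "cone_integral (\<lambda>y. h (norm (y - x)) * f y) x s = h s * cone_integral f x s"
    by (simp add: cone_integral_def set_lebesgue_integral_def)
  then show ?thesis using ball_integral_has_derivative[OF hc s] by (simp add: ac_simps)
qed

text \<open>The weights vanish on the moving sphere, so its motion contributes nothing and only the
  weight itself is differentiated. Expanding into the radial moments \<open>m k\<close> reduces this
  to algebra.\<close>

lemma
  fixes f :: "'a::euclidean_space \<Rightarrow> real"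
  assumes cont: "continuous_on (cball x R) f" and s: "0 < s" "s < R"
  shows ball_integral_weight_has_derivative:
    "((\<lambda>t. ball_integral (\<lambda>y. (t\<^sup>2 - (norm (y - x))\<^sup>2) * f y) x t) has_real_derivative
       2 * s * ball_integral f x s) (at s)" (is ?th1)
  and ball_integral_weight_square_has_derivative:
    "((\<lambda>t. ball_integral (\<lambda>y. (t\<^sup>2 - (norm (y - x))\<^sup>2)\<^sup>2 * f y) x t) has_real_derivative
       4 * s * ball_integral (\<lambda>y. (s\<^sup>2 - (norm (y - x))\<^sup>2) * f y) x s) (at s)" (is ?th2)
proof -
  define m where "m k t = ball_integral (\<lambda>y. norm (y - x) ^ k * f y) x t" for k t
  define c where "c = real DIM('a) * s ^ (DIM('a) - 1) * cone_integral f x s"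
  \<comment> \<open>The derivatives of the moments share the factor \<open>c\<close>, so the
    boundary terms below have coefficients \<open>s^2 - s^2\<close> and
    \<open>s^4 - 2 s^4 + s^4\<close>.\<close>
  have dm: "(m k has_real_derivative s ^ k * c) (at s)" for k
    unfolding m_def c_def by (intro ball_integral_radial_has_derivative[OF cont _ s] continuous_intros)
  have int: "set_integrable lborel (ball x t) (\<lambda>y. norm (y - x) ^ k * f y)" if "t < R" for t k
    using that by (intro set_integrable_cball_continuous[where x=x and R=R] continuous_intros cont) auto
  have m1: "ball_integral (\<lambda>y. (t\<^sup>2 - (norm (y - x))\<^sup>2) * f y) x t = t\<^sup>2 * m 0 t - m 2 t" if "t < R" for t
  proof -
    have "ball_integral (\<lambda>y. (t\<^sup>2 - (norm (y - x))\<^sup>2) * f y) x t =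
       (LINT y:ball x t|lborel. t\<^sup>2 * (norm (y - x) ^ 0 * f y) - norm (y - x) ^ 2 * f y)"
      by (simp add: ball_integral_def algebra_simps)
    also have "\<dots> = t\<^sup>2 * m 0 t - m 2 t"
      using int[OF that] unfolding m_def ball_integral_def
      by (subst set_integral_diff(2)) (auto simp del: power_0)
    finally show ?thesis .
  qed
  have m2: "ball_integral (\<lambda>y. (t\<^sup>2 - (norm (y - x))\<^sup>2)\<^sup>2 * f y) x t = t ^ 4 * m 0 t - 2 * t\<^sup>2 * m 2 t + m 4 t" if "t < R" for t
  proof -
    have "ball_integral (\<lambda>y. (t\<^sup>2 - (norm (y - x))\<^sup>2)\<^sup>2 * f y) x t =
       (LINT y:ball x t|lborel. (t ^ 4 * (norm (y - x) ^ 0 * f y) - 2 * t\<^sup>2 * (norm (y - x) ^ 2 * f y)) + norm (y - x) ^ 4 * f y)"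
      unfolding ball_integral_def
      by (intro arg_cong[where f="set_lebesgue_integral lborel (ball x t)"] ext) algebra
    also have "\<dots> = t ^ 4 * m 0 t - 2 * t\<^sup>2 * m 2 t + m 4 t"
    proof -
      have "set_integrable lborel (ball x t) (\<lambda>y. t ^ 4 * (norm (y - x) ^ 0 * f y))"
       "set_integrable lborel (ball x t) (\<lambda>y. 2 * t\<^sup>2 * (norm (y - x) ^ 2 * f y))"
        using int[OF that] by (auto simp del: power_0)
      then show ?thesis using int[OF that, of 4] unfolding m_def ball_integral_def
        by (simp del: power_0)
    qed
    finally show ?thesis .
  qed
  have "((\<lambda>t. t\<^sup>2 * m 0 t - m 2 t) has_real_derivative 2 * s * m 0 s) (at s)"
    by (rule derivative_eq_intros dm refl | simp add: algebra_simps)+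
  then have "((\<lambda>t. ball_integral (\<lambda>y. (t\<^sup>2 - (norm (y - x))\<^sup>2) * f y) x t) has_real_derivative 2 * s * m 0 s) (at s)"
    by (rule has_field_derivative_transform_within_open[where S="{..<R}"]) (use s m1 in auto)
  then show ?th1 by (simp add: m_def)
  have "((\<lambda>t. t ^ 4 * m 0 t - 2 * t\<^sup>2 * m 2 t + m 4 t) has_real_derivative 4 * s * (s\<^sup>2 * m 0 s - m 2 s)) (at s)"
    by (rule derivative_eq_intros dm refl | simp add: algebra_simps power2_eq_square eval_nat_numeral)+
  then have "((\<lambda>t. ball_integral (\<lambda>y. (t\<^sup>2 - (norm (y - x))\<^sup>2)\<^sup>2 * f y) x t) has_real_derivative 4 * s * (s\<^sup>2 * m 0 s - m 2 s)) (at s)"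
    by (rule has_field_derivative_transform_within_open[where S="{..<R}"]) (use s m2 in auto)
  then show ?th2 using m1[OF s(2)] by simp
qed

section \<open>Radial derivative of the cone integral, and the flux\<close>

text \<open>For \<open>s > 0\<close>, multiplying by \<open>real DIM('a) * s ^ (DIM('a) - 1)\<close>
  gives the flux of the gradient through the sphere of radius \<open>s\<close>.\<close>

definition cone_normal_derivative :: "('a::euclidean_space \<Rightarrow> real) \<Rightarrow> 'a \<Rightarrow> real \<Rightarrow> real" where
  "cone_normal_derivative v x s = (LINT y:ball 0 1|lborel. (\<Sum>b\<in>Basis. (sgn y \<bullet> b) * dir_deriv v b (x + s *\<^sub>R sgn y)))"

text \<open>Chain rule along each ray, with a bound uniform over directions. Admitting
  \<open>s = 0\<close> yields the continuity at the centre that the comparison of solutions relies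
  on.\<close>

lemma cone_integral_has_derivative:
  fixes v :: "'a::euclidean_space \<Rightarrow> real"
  assumes D: "open D" and v: "C1_on D v" and sub: "cball x R \<subseteq> D" and s: "\<bar>s\<bar> < R"
  shows "(cone_integral v x has_real_derivative cone_normal_derivative v x s) (at s)"
proof -
  have cont: "continuous_on (cball x R) v" and cont': "\<And>b. b \<in> Basis \<Longrightarrow> continuous_on (cball x R) (dir_deriv v b)"
    using v sub unfolding C1_on_def by (meson continuous_on_subset)+
  have "\<exists>B. \<forall>y\<in>cball x R. \<bar>dir_deriv v b y\<bar> \<le> B" if "b \<in> Basis" for b
    using continuous_on_cball_bounded[OF cont'[OF that]] by metis
  then obtain B where B: "\<And>b y. b \<in> Basis \<Longrightarrow> y \<in> cball x R \<Longrightarrow> \<bar>dir_deriv v b y\<bar> \<le> B b" by metis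
  have inD: "x + t *\<^sub>R sgn y \<in> cball x R" if "\<bar>t\<bar> < R" for t y
    using that by (auto simp: norm_sgn dist_norm)
  have "((\<lambda>t. \<integral>y. indicator (ball 0 1) y *\<^sub>R v (x + t *\<^sub>R sgn y) \<partial>lborel) has_real_derivative
    (\<integral>y. indicator (ball 0 1) y *\<^sub>R (\<Sum>b\<in>Basis. (sgn y \<bullet> b) * dir_deriv v b (x + s *\<^sub>R sgn y)) \<partial>lborel)) (at s)"
  proof (rule has_real_derivative_integral[where \<delta>="R - \<bar>s\<bar>" and w="\<lambda>y. indicator (ball 0 1) y * sum B Basis"])
    fix t assume "\<bar>t - s\<bar> < R - \<bar>s\<bar>"
    then have t: "\<bar>t\<bar> < R" by linarith
    show "integrable lborel (\<lambda>y. indicator (ball 0 1) y *\<^sub>R v (x + t *\<^sub>R sgn y))"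
      using set_integrable_continuous_sgn[OF cont, of t 0 1 0] t by (simp add: set_integrable_def)
    fix y :: 'a
    show "((\<lambda>t. indicator (ball 0 1) y *\<^sub>R v (x + t *\<^sub>R sgn y)) has_real_derivative
       indicator (ball 0 1) y *\<^sub>R (\<Sum>b\<in>Basis. (sgn y \<bullet> b) * dir_deriv v b (x + t *\<^sub>R sgn y))) (at t)"
      unfolding real_scaleR_def using inD[OF t] sub
      by (intro DERIV_cmult C1_on_has_real_derivative_line[OF D v]) blast
    have "\<bar>\<Sum>b\<in>Basis. (sgn y \<bullet> b) * dir_deriv v b (x + t *\<^sub>R sgn y)\<bar> \<le> sum B Basis"
    proof (rule order_trans[OF sum_abs], rule sum_mono)
      fix b :: 'a assume b: "b \<in> Basis"
      have "\<bar>sgn y \<bullet> b\<bar> \<le> 1" using Basis_le_norm[OF b, of "sgn y"] by (auto simp: norm_sgn split: if_splits)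
      then have "\<bar>sgn y \<bullet> b\<bar> * \<bar>dir_deriv v b (x + t *\<^sub>R sgn y)\<bar> \<le> 1 * B b"
        using B[OF b inD[OF t]] by (intro mult_mono) auto
      then show "\<bar>(sgn y \<bullet> b) * dir_deriv v b (x + t *\<^sub>R sgn y)\<bar> \<le> B b" by (simp add: abs_mult)
    qed
    then show "\<bar>indicator (ball 0 1) y *\<^sub>R (\<Sum>b\<in>Basis. (sgn y \<bullet> b) * dir_deriv v b (x + t *\<^sub>R sgn y))\<bar> \<le> indicator (ball 0 1) y * sum B Basis"
      by (auto simp: indicator_def)
  next
    show "integrable lborel (\<lambda>y::'a. indicator (ball 0 1) y * sum B Basis)"
      using emeasure_lborel_ball_finite[of "0::'a" 1] by (intro integrable_mult_left integrable_real_indicator) auto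
  qed (use s in auto)
  then show ?thesis by (simp add: cone_integral_def[abs_def] set_lebesgue_integral_def cone_normal_derivative_def)
qed

text \<open>The divergence theorem for a gradient on a ball: differentiating the weighted identity twice in the
  radius removes the weights.\<close>
lemma ball_integral_laplacian:
  fixes v :: "'a::euclidean_space \<Rightarrow> real"
  assumes D: "open D" and v: "C2_on D v" and sub: "cball x R \<subseteq> D" and s: "0 < s" "s < R"
  shows "ball_integral (laplacian v) x s = real DIM('a) * s ^ (DIM('a) - 1) * cone_normal_derivative v x s"
proof -
  \<comment> \<open>The radial component of the gradient times the distance to \<open>x\<close>; it
    collects the right sides of the integrations by parts over all coordinates.\<close>
  define Q where "Q y = (\<Sum>b\<in>Basis. ((y - x) \<bullet> b) * dir_deriv v b y)" for y
  have C1: "C1_on D (dir_deriv v b)" if "b \<in> Basis" for b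
    using v that by (simp add: C2_on_def)
  have c1: "continuous_on (cball x R) (dir_deriv v b)" if "b \<in> Basis" for b
    using C1[OF that] sub unfolding C1_on_def by (meson continuous_on_subset)
  have c2: "continuous_on (cball x R) (dir_deriv (dir_deriv v b) b)" if "b \<in> Basis" for b
    using C1[OF that] sub that unfolding C1_on_def by (meson continuous_on_subset)
  have cQ: "continuous_on (cball x R) Q" unfolding Q_def by (intro continuous_intros c1)
  have cL: "continuous_on (cball x R) (laplacian v)" unfolding laplacian_def[abs_def] by (intro continuous_intros c2)
  have E2: "ball_integral (\<lambda>y. (t\<^sup>2 - (norm (y - x))\<^sup>2)\<^sup>2 * laplacian v y) x t =
     4 * ball_integral (\<lambda>y. (t\<^sup>2 - (norm (y - x))\<^sup>2) * Q y) x t" if t: "0 < t" "t < R" for t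
  proof -
    have subt: "cball x t \<subseteq> cball x R" using t by auto
    have "ball_integral (\<lambda>y. (t\<^sup>2 - (norm (y - x))\<^sup>2)\<^sup>2 * laplacian v y) x t =
      (\<Sum>b\<in>Basis. ball_integral (\<lambda>y. (t\<^sup>2 - (norm (y - x))\<^sup>2)\<^sup>2 * dir_deriv (dir_deriv v b) b y) x t)"
      unfolding laplacian_def sum_distrib_left using t
      by (intro ball_integral_sum set_integrable_cball_continuous[where x=x and R=R] continuous_intros c2) auto
    also have "\<dots> = (\<Sum>b\<in>Basis. 4 * ball_integral (\<lambda>y. (t\<^sup>2 - (norm (y - x))\<^sup>2) * (((y - x) \<bullet> b) * dir_deriv v b y)) x t)"
      using subt sub t by (intro sum.cong refl ball_integral_by_parts[OF D C1]) auto
    also have "\<dots> = 4 * (\<Sum>b\<in>Basis. ball_integral (\<lambda>y. (t\<^sup>2 - (norm (y - x))\<^sup>2) * (((y - x) \<bullet> b) * dir_deriv v b y)) x t)"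
      by (simp add: sum_distrib_left)
    also have "(\<Sum>b\<in>Basis. ball_integral (\<lambda>y. (t\<^sup>2 - (norm (y - x))\<^sup>2) * (((y - x) \<bullet> b) * dir_deriv v b y)) x t) =
       ball_integral (\<lambda>y. (t\<^sup>2 - (norm (y - x))\<^sup>2) * Q y) x t"
      unfolding Q_def sum_distrib_left using t
      by (intro ball_integral_sum[symmetric] set_integrable_cball_continuous[where x=x and R=R] continuous_intros c1) auto
    finally show ?thesis .
  qed
  \<comment> \<open>Differentiating \<open>E2\<close> in the radius lowers the weight by one power
    on each side; the common factor \<open>4 * t\<close> cancels.\<close>
  have E1: "ball_integral (\<lambda>y. (t\<^sup>2 - (norm (y - x))\<^sup>2) * laplacian v y) x t = 2 * ball_integral Q x t"
    if t: "0 < t" "t < R" for t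
  proof -
    have "((\<lambda>t. ball_integral (\<lambda>y. (t\<^sup>2 - (norm (y - x))\<^sup>2)\<^sup>2 * laplacian v y) x t) has_real_derivative 4 * (2 * t * ball_integral Q x t)) (at t)"
      by (rule has_field_derivative_transform_within_open[OF DERIV_cmult[OF ball_integral_weight_has_derivative[OF cQ t]], where S="{0<..<R}"])
        (use t E2 in auto)
    from DERIV_unique[OF this ball_integral_weight_square_has_derivative[OF cL t]]
    show ?thesis using t by simp
  qed
  have "((\<lambda>t. ball_integral (\<lambda>y. (t\<^sup>2 - (norm (y - x))\<^sup>2) * laplacian v y) x t) has_real_derivative
     2 * (real DIM('a) * s ^ (DIM('a) - 1) * cone_integral Q x s)) (at s)"
    by (rule has_field_derivative_transform_within_open[OF DERIV_cmult[OF ball_integral_has_derivative[OF cQ s]], where S="{0<..<R}"])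
      (use s E1 in auto)
  from DERIV_unique[OF this ball_integral_weight_has_derivative[OF cL s]]
  have "s * ball_integral (laplacian v) x s = real DIM('a) * s ^ (DIM('a) - 1) * cone_integral Q x s" by simp
  \<comment> \<open>At \<open>x + s *\<^sub>R sgn y\<close> the vector from the centre is
    \<open>s\<close> times the unit normal.\<close>
  moreover have "cone_integral Q x s = s * cone_normal_derivative v x s"
    by (simp add: cone_integral_def cone_normal_derivative_def Q_def sum_distrib_left[symmetric] mult.assoc)
  ultimately show ?thesis using s by simp
qed

subsection \<open>Bessel functions and the radial system\<close>

text \<open>The entire function with \<open>I\<^sub>\<nu>(t) = (t/2)\<^sup>\<nu> C\<^bsub>\<nu>+1\<^esub>(t\<^sup>2/4)\<close>; the index is that of
  the leading Gamma factor.\<close>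
definition bessel_clifford :: "real \<Rightarrow> real \<Rightarrow> real" where
  "bessel_clifford a z = (\<Sum>k. inverse (fact k * Gamma (a + real k)) * z ^ k)"

text \<open>Gamma dips between 1 and 2, so only integer steps are compared: each multiplies by a
  factor of at least 1.\<close>

lemma Gamma_le_Gamma_add_nat:
  fixes a :: real
  assumes "a \<ge> 1"
  shows "Gamma a \<le> Gamma (a + real k)"
proof (induction k)
  case (Suc k)
  have "Gamma (a + real k) \<le> (a + real k) * Gamma (a + real k)"
    using Gamma_real_pos[of "a + real k"] assms by simp
  also have "\<dots> = Gamma (a + real k + 1)"
    using assms by (intro Gamma_plus1[symmetric]) (auto dest: nonpos_Ints_nonpos)
  also have "a + real k + 1 = a + real (Suc k)" by simp
  finally show ?case using Suc by simp
qed simp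

text \<open>The Gamma factors are bounded below by \<open>Gamma a\<close>, which leaves the
  exponential series as majorant.\<close>

lemma summable_bessel_clifford:
  fixes a z :: real
  assumes a: "a \<ge> 1"
  shows "summable (\<lambda>k. inverse (fact k * Gamma (a + real k)) * z ^ k)"
proof (rule summable_comparison_test')
  show "summable (\<lambda>k. inverse (Gamma a) * (inverse (fact k) * \<bar>z\<bar> ^ k))"
    by (intro summable_mult summable_exp)
  fix k
  have G: "Gamma a > 0" using a by simp
  have "inverse (Gamma (a + real k)) \<le> inverse (Gamma a)"
    by (rule le_imp_inverse_le[OF Gamma_le_Gamma_add_nat[OF a] G])
  moreover have "Gamma (a + real k) > 0" using a by simp
  ultimately show "norm (inverse (fact k * Gamma (a + real k)) * z ^ k) \<le> inverse (Gamma a) * (inverse (fact k) * \<bar>z\<bar> ^ k)"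
    by (simp add: abs_mult power_abs mult_right_mono mult_left_mono)
qed

lemma bessel_clifford_pos:
  assumes "a \<ge> 1" "z \<ge> 0"
  shows "bessel_clifford a z > 0"
  unfolding bessel_clifford_def
proof (rule suminf_pos2[OF summable_bessel_clifford[OF assms(1)], of _ 0])
  show "0 \<le> inverse (fact k * Gamma (a + real k)) * z ^ k" for k
    using assms Gamma_real_pos[of "a + real k"] by simp
qed (use assms in auto)

lemma bessel_clifford_0 [simp]: "bessel_clifford a 0 = inverse (Gamma a)"
  by (simp add: bessel_clifford_def)

lemma diffs_bessel_clifford:
  fixes a :: real
  shows "diffs (\<lambda>k. inverse (fact k * Gamma (a + real k))) = (\<lambda>k. inverse (fact k * Gamma (a + 1 + real k)))"
proof
  fix k
  have "a + real (Suc k) = a + 1 + real k" by simp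
  then show "diffs (\<lambda>k. inverse (fact k * Gamma (a + real k))) k = inverse (fact k * Gamma (a + 1 + real k))"
    unfolding diffs_def by (simp only:) (simp del: of_nat_Suc add: field_simps)
qed

lemma bessel_clifford_has_derivative:
  assumes "a \<ge> 1"
  shows "(bessel_clifford a has_real_derivative bessel_clifford (a + 1) z) (at z)"
  using termdiffs_strong_converges_everywhere[OF summable_bessel_clifford[OF assms]]
  unfolding diffs_bessel_clifford bessel_clifford_def[abs_def] .

text \<open>Multiplying the derivative by \<open>z\<close> multiplies the k-th coefficient by
  \<open>k\<close>, and \<open>a + k\<close> is the ratio of the Gamma factors of indices
  \<open>a + 1\<close> and \<open>a\<close>. For Bessel functions this is the three-term recurrence
  linking orders \<open>a - 1\<close>, \<open>a\<close> and \<open>a + 1\<close>.\<close>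

lemma bessel_clifford_recurrence:
  fixes a z :: real
  assumes a: "a \<ge> 1"
  shows "a * bessel_clifford (a + 1) z + z * bessel_clifford (a + 2) z = bessel_clifford a z"
proof -
  let ?c = "\<lambda>a k. inverse (fact k * Gamma (a + real k))"
  have a1: "a + 1 \<ge> 1" and a2: "a + 1 + 1 \<ge> 1" using a by auto
  have s1: "(\<lambda>k. ?c (a + 1) k * z ^ k) sums bessel_clifford (a + 1) z"
    unfolding bessel_clifford_def by (rule summable_sums[OF summable_bessel_clifford[OF a1]])
  have "summable (\<lambda>k. diffs (?c (a + 1)) k * z ^ k)"
    unfolding diffs_bessel_clifford by (rule summable_bessel_clifford[OF a2])
  from diffs_equiv[OF this]
  have "(\<lambda>k. real k * ?c (a + 1) k * z ^ (k - Suc 0)) sums bessel_clifford (a + 2) z"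
    unfolding diffs_bessel_clifford by (simp add: bessel_clifford_def add_ac)
  from sums_add[OF sums_mult[OF s1, of a] sums_mult[OF this, of z]]
  have "(\<lambda>k. a * (?c (a + 1) k * z ^ k) + z * (real k * ?c (a + 1) k * z ^ (k - Suc 0))) sums
     (a * bessel_clifford (a + 1) z + z * bessel_clifford (a + 2) z)" .
  moreover have "a * (?c (a + 1) k * z ^ k) + z * (real k * ?c (a + 1) k * z ^ (k - Suc 0)) = ?c a k * z ^ k" for k
  proof -
    have "Gamma (a + real k + 1) = (a + real k) * Gamma (a + real k)"
      using a by (intro Gamma_plus1) (auto dest: nonpos_Ints_nonpos)
    then have G: "?c (a + 1) k = ?c a k / (a + real k)"
      by (simp add: add_ac field_simps)
    \<comment> \<open>At \<open>k = 0\<close> the truncated exponent does no harm, since the factor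
      \<open>real k\<close> vanishes.\<close>
    have "z * (real k * ?c (a + 1) k * z ^ (k - Suc 0)) = real k * ?c (a + 1) k * z ^ k"
      by (cases k) auto
    then have "a * (?c (a + 1) k * z ^ k) + z * (real k * ?c (a + 1) k * z ^ (k - Suc 0)) = (a + real k) * ?c (a + 1) k * z ^ k"
      by (simp add: algebra_simps)
    also have "\<dots> = ?c a k * z ^ k" using a unfolding G by simp
    finally show ?thesis .
  qed
  ultimately show ?thesis
    unfolding bessel_clifford_def[of a] by (simp add: sums_iff)
qed

lemma Bessel_I_eq_bessel_clifford:
  assumes "t > 0" "\<nu> \<ge> 0"
  shows "Bessel_I \<nu> t = (t / 2) powr \<nu> * bessel_clifford (\<nu> + 1) ((t / 2)\<^sup>2)"
proof -
  have "(t / 2) powr (2 * real k + \<nu>) / (fact k * Gamma (\<nu> + real k + 1)) =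
     (t / 2) powr \<nu> * (inverse (fact k * Gamma (\<nu> + 1 + real k)) * ((t / 2)\<^sup>2) ^ k)" for k
  proof -
    have "(t / 2) powr (2 * real k) = ((t / 2)\<^sup>2) ^ k"
      using assms powr_realpow[of "t / 2" "2 * k"] by (simp add: power_mult)
    moreover have "\<nu> + real k + 1 = \<nu> + 1 + real k" by simp
    ultimately show ?thesis by (simp only: powr_add divide_inverse mult_ac)
  qed
  then show ?thesis
    unfolding Bessel_I_def bessel_clifford_def using assms(2)
    by (simp only:) (rule suminf_mult[OF summable_bessel_clifford], simp)
qed

section \<open>Comparison with the radial solution\<close>

text \<open>In the application \<open>q\<close> is \<open>\<mu>\<^sup>2 / p\<close> and
  \<open>p\<close> vanishes at 0, a singular point of the system. Hence the equations are imposed on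
  the open interval only, with continuity up to the endpoints.\<close>

lemma proportional_solutions:
  fixes A \<Phi> U W p :: "real \<Rightarrow> real"
  assumes r: "0 < r"
    and cont: "continuous_on {0..r} A" "continuous_on {0..r} \<Phi>" "continuous_on {0..r} U" "continuous_on {0..r} W"
    and init: "A 0 = 0" "\<Phi> 0 = 0"
    and W: "\<And>s. 0 \<le> s \<Longrightarrow> s \<le> r \<Longrightarrow> W s \<noteq> 0"
    and A': "\<And>s. 0 < s \<Longrightarrow> s < r \<Longrightarrow> (A has_real_derivative p s * U s) (at s)"
    and \<Phi>': "\<And>s. 0 < s \<Longrightarrow> s < r \<Longrightarrow> (\<Phi> has_real_derivative p s * W s) (at s)"
    and U': "\<And>s. 0 < s \<Longrightarrow> s < r \<Longrightarrow> (U has_real_derivative q s * A s) (at s)"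
    and W': "\<And>s. 0 < s \<Longrightarrow> s < r \<Longrightarrow> (W has_real_derivative q s * \<Phi> s) (at s)"
  shows "A r * W 0 = \<Phi> r * U 0"
proof -
  have wronskian: "A s * W s - \<Phi> s * U s = 0" if s: "0 \<le> s" "s \<le> r" for s
  proof -
    have "A s * W s - \<Phi> s * U s = A 0 * W 0 - \<Phi> 0 * U 0"
    proof (rule DERIV_isconst2[OF r _ _ s])
      show "continuous_on {0..r} (\<lambda>s. A s * W s - \<Phi> s * U s)" by (intro continuous_intros cont)
      fix s assume s: "0 < s" "s < r"
      show "((\<lambda>s. A s * W s - \<Phi> s * U s) has_real_derivative 0) (at s)"
        using DERIV_diff[OF DERIV_mult[OF A'[OF s] W'[OF s]] DERIV_mult[OF \<Phi>'[OF s] U'[OF s]]]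
        by (simp add: algebra_simps)
    qed
    then show ?thesis by (simp add: init)
  qed
  have "U r / W r = U 0 / W 0"
  proof (rule DERIV_isconst_end[OF r])
    show "continuous_on {0..r} (\<lambda>s. U s / W s)" using W by (intro continuous_intros cont) auto
    fix s assume s: "0 < s" "s < r"
    \<comment> \<open>The numerator of the derivative of \<open>U / W\<close> is \<open>q\<close>
      times the Wronskian.\<close>
    have "q s * A s * W s - U s * (q s * \<Phi> s) = 0"
      using wronskian[of s] s by (simp add: algebra_simps)
    then show "((\<lambda>s. U s / W s) has_real_derivative 0) (at s)"
      using DERIV_divide[OF U'[OF s] W'[OF s] W[of s]] s by (simp only:) simp
  qed
  then have "U r * W 0 = U 0 * W r" using W[of 0] W[of r] r by (simp add: field_simps)
  moreover have "A r * W r = \<Phi> r * U r" using wronskian[of r] r by simp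
  ultimately have "W r * (A r * W 0) = W r * (\<Phi> r * U 0)" by algebra
  then show ?thesis using W[of r] r by simp
qed

lemma abs_ball_integral_le:
  fixes f :: "'a::euclidean_space \<Rightarrow> real"
  assumes cont: "continuous_on (cball x R) f" and B: "\<And>y. y \<in> cball x R \<Longrightarrow> \<bar>f y\<bar> \<le> B" and s: "0 \<le> s" "s \<le> R"
  shows "\<bar>ball_integral f x s\<bar> \<le> B * (unit_ball_vol DIM('a) * s ^ DIM('a))"
proof -
  have int: "set_integrable lborel (ball x s) f"
    using s by (intro set_integrable_cball_continuous[OF cont]) auto
  have cint: "set_integrable lborel (ball x s) (\<lambda>y. B)"
    using s by (intro set_integrable_cball_continuous[where x=x and R=R]) auto
  have "\<bar>ball_integral f x s\<bar> \<le> (LINT y:ball x s|lborel. \<bar>f y\<bar>)"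
    using set_integral_norm_bound[OF int] by (simp add: ball_integral_def)
  also have "\<dots> \<le> (LINT y:ball x s|lborel. B)"
    using s B by (intro set_integral_mono set_integrable_abs int cint) auto
  also have "\<dots> = B * measure lborel (ball x s)"
    by (simp add: set_lebesgue_integral_def)
  finally show ?thesis using s by (simp add: content_ball)
qed

text \<open>The derivative formula covers positive radii; at 0 the integral is squeezed by the
  volume of the ball.\<close>

lemma continuous_on_ball_integral:
  fixes f :: "'a::euclidean_space \<Rightarrow> real"
  assumes cont: "continuous_on (cball x R) f" and r: "r < R"
  shows "continuous_on {0..r} (ball_integral f x)"
  unfolding continuous_on_eq_continuous_within
proof
  fix s assume s: "s \<in> {0..r}"
  show "continuous (at s within {0..r}) (ball_integral f x)"
  proof (cases "s = 0")
    case False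
    then have "isCont (ball_integral f x) s"
      using s r by (intro DERIV_isCont[OF ball_integral_has_derivative[OF cont]]) auto
    then show ?thesis by (rule continuous_at_imp_continuous_at_within)
  next
    case True
    obtain B where B: "\<And>y. y \<in> cball x R \<Longrightarrow> \<bar>f y\<bar> \<le> B"
      using continuous_on_cball_bounded[OF cont] by blast
    have "(ball_integral f x \<longlongrightarrow> 0) (at 0 within {0..r})"
    proof (rule Lim_null_comparison)
      show "\<forall>\<^sub>F s in at 0 within {0..r}. norm (ball_integral f x s) \<le> B * (unit_ball_vol DIM('a) * s ^ DIM('a))"
        using abs_ball_integral_le[OF cont B] r by (auto simp: eventually_at_filter)
      show "((\<lambda>s. B * (unit_ball_vol DIM('a) * s ^ DIM('a))) \<longlongrightarrow> 0) (at 0 within {0..r})"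
        using DIM_positive[where 'a='a] by (auto intro!: tendsto_eq_intros simp: zero_power)
    qed
    then show ?thesis by (simp add: True continuous_within)
  qed
qed

lemma cone_integral_0: "cone_integral (f :: 'a::euclidean_space \<Rightarrow> real) x 0 = unit_ball_vol DIM('a) * f x"
  by (simp add: cone_integral_def set_lebesgue_integral_def content_ball)

text \<open>The solid mean value formula. The flux formula follows from it, since the flux is
  \<open>\<mu>\<^sup>2\<close> times this integral.\<close>

lemma ball_integral_modified_helmholtz:
  fixes v :: "'a::euclidean_space \<Rightarrow> real"
  assumes m: "DIM('a) \<ge> 2" and D: "open D" and \<mu>: "\<mu> > 0" and v: "C2_on D v"
    and eq: "\<And>y. y \<in> D \<Longrightarrow> laplacian v y = \<mu>\<^sup>2 * v y"
    and r: "0 < r" "r < R" and sub: "cball x R \<subseteq> D"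
  shows "ball_integral v x r = (2 * pi * r / \<mu>) powr (real DIM('a) / 2) * Bessel_I (real DIM('a) / 2) (\<mu> * r) * v x"
proof -
  define a where "a = real DIM('a) / 2"
  \<comment> \<open>Dimension at least 2 enters here: the series lemmas are applied with index
    \<open>a\<close> and require \<open>a \<ge> 1\<close>.\<close>
  have a: "a \<ge> 1" "a + 1 \<ge> 1" and ma: "real DIM('a) = 2 * a" using m by (auto simp: a_def)
  define z where "z s = (\<mu> * s / 2)\<^sup>2" for s :: real
  define p where "p s = real DIM('a) * s ^ (DIM('a) - 1)" for s :: real
  \<comment> \<open>\<open>\<Phi>\<close> and \<open>W\<close> are closed forms of the ball and cone
    integrals of the radial solution with value 1 at the centre.\<close>
  define \<Phi> where "\<Phi> s = pi powr a * s ^ DIM('a) * bessel_clifford (a + 1) (z s)" for s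
  define W where "W s = pi powr a / a * bessel_clifford a (z s)" for s
  have v1: "C1_on D v" using v by (simp add: C2_on_def)
  have cont: "continuous_on (cball x R) v"
    using v1 sub unfolding C1_on_def by (meson continuous_on_subset)
  have sm: "s * s ^ (DIM('a) - 1) = s ^ DIM('a)" for s :: real
    using m by (cases "DIM('a)") auto
  have p: "p s > 0" if "s > 0" for s using that by (simp add: p_def)
  have dz: "(z has_real_derivative \<mu>\<^sup>2 * s / 2) (at s)" for s
    unfolding z_def by (auto intro!: derivative_eq_intros simp: power2_eq_square)
  have dW: "(W has_real_derivative \<mu>\<^sup>2 / p s * \<Phi> s) (at s)" if "s > 0" for s
  proof -
    have "(W has_real_derivative pi powr a / a * (bessel_clifford (a + 1) (z s) * (\<mu>\<^sup>2 * s / 2))) (at s)"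
      unfolding W_def by (intro DERIV_cmult DERIV_chain2[OF bessel_clifford_has_derivative dz] a)
    moreover have "pi powr a / a * (bessel_clifford (a + 1) (z s) * (\<mu>\<^sup>2 * s / 2)) = \<mu>\<^sup>2 / p s * \<Phi> s"
      using that a unfolding p_def \<Phi>_def ma sm[symmetric] by (simp add: field_simps)
    ultimately show ?thesis by simp
  qed
  have d\<Phi>: "(\<Phi> has_real_derivative p s * W s) (at s)" for s
  proof -
    have "(\<Phi> has_real_derivative (pi powr a * (real DIM('a) * s ^ (DIM('a) - 1))) * bessel_clifford (a + 1) (z s) +
        (bessel_clifford (a + 1 + 1) (z s) * (\<mu>\<^sup>2 * s / 2)) * (pi powr a * s ^ DIM('a))) (at s)"
      unfolding \<Phi>_def using DERIV_pow[of "DIM('a)" s]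
      by (intro DERIV_mult DERIV_cmult DERIV_chain2[OF bessel_clifford_has_derivative dz] a) simp
    moreover have "(pi powr a * (real DIM('a) * s ^ (DIM('a) - 1))) * bessel_clifford (a + 1) (z s) +
        (bessel_clifford (a + 1 + 1) (z s) * (\<mu>\<^sup>2 * s / 2)) * (pi powr a * s ^ DIM('a)) =
        2 * pi powr a * s ^ (DIM('a) - 1) * (a * bessel_clifford (a + 1) (z s) + z s * bessel_clifford (a + 2) (z s))"
      unfolding ma sm[symmetric] by (simp add: z_def power2_eq_square algebra_simps)
    moreover have "\<dots> = p s * W s"
      unfolding bessel_clifford_recurrence[OF a(1)] p_def W_def ma using a by simp
    ultimately show ?thesis by simp
  qed
  have dU: "(cone_integral v x has_real_derivative \<mu>\<^sup>2 / p s * ball_integral v x s) (at s)" if s: "0 < s" "s < r" for s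
  proof -
    have "ball_integral (laplacian v) x s = \<mu>\<^sup>2 * ball_integral v x s"
    proof -
      have "ball x s \<subseteq> D" using sub s r by (auto simp: subset_iff)
      then have "ball_integral (laplacian v) x s = ball_integral (\<lambda>y. \<mu>\<^sup>2 * v y) x s"
        unfolding ball_integral_def using eq by (intro set_lebesgue_integral_cong) auto
      then show ?thesis by (simp add: ball_integral_def)
    qed
    then have "\<mu>\<^sup>2 * ball_integral v x s = p s * cone_normal_derivative v x s"
      using ball_integral_laplacian[OF D v sub, of s] s r by (simp add: p_def)
    then have "cone_normal_derivative v x s = \<mu>\<^sup>2 / p s * ball_integral v x s" using p[OF s(1)] by (simp add: field_simps)
    then show ?thesis using cone_integral_has_derivative[OF D v1 sub, of s] s r by simp
  qed
  have "ball_integral v x r * W 0 = \<Phi> r * cone_integral v x 0"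
  proof (rule proportional_solutions[where A="ball_integral v x" and U="cone_integral v x" and \<Phi>=\<Phi> and W=W and r=r and p=p and q="\<lambda>s. \<mu>\<^sup>2 / p s"])
    show "continuous_on {0..r} (ball_integral v x)" by (rule continuous_on_ball_integral[OF cont r(2)])
    show "continuous_on {0..r} \<Phi>"
      using d\<Phi> by (intro continuous_at_imp_continuous_on ballI DERIV_isCont)
    show "continuous_on {0..r} (cone_integral v x)"
      using DERIV_isCont[OF cone_integral_has_derivative[OF D v1 sub]] r
      by (intro continuous_at_imp_continuous_on ballI) auto
    have "isCont (\<lambda>s. bessel_clifford a (z s)) s" for s
      by (rule DERIV_isCont[OF DERIV_chain2[OF bessel_clifford_has_derivative[OF a(1)] dz]])
    then show "continuous_on {0..r} W"
      unfolding W_def by (intro continuous_intros continuous_at_imp_continuous_on) auto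
    show "W s \<noteq> 0" for s
      using bessel_clifford_pos[OF a(1), of "z s"] a by (auto simp: W_def z_def)
    show "(ball_integral v x has_real_derivative p s * cone_integral v x s) (at s)" if "0 < s" "s < r" for s
      unfolding p_def using that r by (intro ball_integral_has_derivative[OF cont]) auto
  qed (use r dW d\<Phi> dU in \<open>auto simp: \<Phi>_def\<close>)
  \<comment> \<open>This normalization cancels the unit ball volume in
    \<open>cone_integral v x 0\<close>, leaving exactly \<open>v x\<close>.\<close>
  moreover have "W 0 = unit_ball_vol DIM('a)"
  proof -
    have "Gamma (a + 1) = a * Gamma a" using a by (intro Gamma_plus1) (auto dest: nonpos_Ints_nonpos)
    then show ?thesis by (simp add: W_def z_def unit_ball_vol_def a_def[symmetric] field_simps)
  qed
  ultimately have "ball_integral v x r = \<Phi> r * v x"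
    using less_imp_neq[OF unit_ball_vol_pos[OF of_nat_0_le_iff, of "DIM('a)"]] by (simp add: cone_integral_0)
  moreover have "\<Phi> r = (2 * pi * r / \<mu>) powr a * Bessel_I a (\<mu> * r)"
  proof -
    \<comment> \<open>The bases multiply to \<open>pi * (r * r)\<close>, so \<open>\<mu>\<close>
      disappears; as \<open>2 * a\<close> is the dimension, an integer power of \<open>r\<close>
      remains.\<close>
    have "(2 * pi * r / \<mu>) powr a * (\<mu> * r / 2) powr a = (pi * (r * r)) powr a"
      using r \<mu> by (subst powr_mult[symmetric]) (auto simp: field_simps)
    also have "\<dots> = pi powr a * (r powr a * r powr a)"
      using r by (simp add: powr_mult)
    also have "r powr a * r powr a = r ^ DIM('a)"
      using r by (simp add: powr_add[symmetric] a_def powr_realpow)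
    finally have "(2 * pi * r / \<mu>) powr a * (\<mu> * r / 2) powr a = pi powr a * r ^ DIM('a)" .
    moreover have "Bessel_I a (\<mu> * r) = (\<mu> * r / 2) powr a * bessel_clifford (a + 1) ((\<mu> * r / 2)\<^sup>2)"
      by (rule Bessel_I_eq_bessel_clifford) (use r \<mu> a in auto)
    ultimately show ?thesis unfolding \<Phi>_def z_def by simp
  qed
  ultimately show ?thesis by (simp add: a_def)
qed

subsection \<open>The flux through the sphere\<close>

lemma integral_scale_measure:
  fixes f :: "'a \<Rightarrow> real"
  assumes "c \<ge> 0" and f: "f \<in> borel_measurable M"
  shows "integral\<^sup>L (scale_measure (ennreal c) M) f = c * integral\<^sup>L M f"
proof -
  have "scale_measure (ennreal c) M = density M (\<lambda>_. ennreal c)"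
    by (rule measure_eqI) (auto simp: emeasure_density nn_integral_cmult_indicator)
  then show ?thesis using assms by (simp add: integral_density)
qed

text \<open>Since \<open>radial_proj\<close> is the map \<open>x + r *\<^sub>R sgn (y - x)\<close>,
  the cone definition of surface measure turns sphere integrals into ball integrals of functions of
  the direction.\<close>

lemma integral_sphere_measure:
  fixes f :: "'a::euclidean_space \<Rightarrow> real"
  assumes f: "f \<in> borel_measurable borel" and r: "r > 0"
  shows "integral\<^sup>L (sphere_measure x r) f =
    real DIM('a) / r * (LINT y:ball x r - {x}|lborel. f (x + r *\<^sub>R sgn (y - x)))"
proof -
  have rp: "radial_proj x r y = x + r *\<^sub>R sgn (y - x)" for y
    by (simp add: radial_proj_def sgn_div_norm divide_inverse)
  have m: "radial_proj x r \<in> measurable (restrict_space lborel (ball x r - {x})) borel"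
    by (intro measurable_restrict_space1) simp
  show ?thesis
    unfolding sphere_measure_def using r f
    by (simp add: integral_scale_measure integral_distr[OF m] integral_restrict_space set_lebesgue_integral_def rp)
qed

text \<open>At the projected point the outward normal is \<open>sgn (y - x)\<close>. Homogeneity
  then supplies \<open>r ^ DIM('a)\<close>, which combines with the factor \<open>DIM / r\<close> of
  the surface measure.\<close>

lemma integral_sphere_normal_derivative:
  fixes v :: "'a::euclidean_space \<Rightarrow> real"
  assumes D: "open D" and v: "C1_on D v" and sub: "cball x r \<subseteq> D" and r: "r > 0"
  shows "(LINT y:sphere x r|sphere_measure x r. dir_deriv v (outward_normal x r y) y) =
     real DIM('a) * r ^ (DIM('a) - 1) * cone_normal_derivative v x r"
proof -
  define h where "h w = (\<Sum>b\<in>Basis. (w \<bullet> b) * dir_deriv v b (x + r *\<^sub>R w))" for w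
  \<comment> \<open>Expanding in coordinates and extending by zero off the sphere gives a Borel
    function on the whole space.\<close>
  define K where "K y = indicator (sphere x r) y *\<^sub>R (\<Sum>b\<in>Basis. (outward_normal x r y \<bullet> b) * dir_deriv v b y)" for y
  have cont: "continuous_on (cball x r) (dir_deriv v b)" if "b \<in> Basis" for b
    using v sub that unfolding C1_on_def by (meson continuous_on_subset)
  have "continuous_on (sphere x r) (dir_deriv v b)" if "b \<in> Basis" for b
    using cont[OF that] by (rule continuous_on_subset) auto
  then have "K \<in> borel_measurable borel"
    unfolding K_def outward_normal_def using r
    by (intro borel_measurable_continuous_on_indicator continuous_intros) auto
  have hm: "(\<lambda>y. h (sgn (y - x))) \<in> borel_measurable borel"
  proof -
    have "(\<lambda>y. sgn (y - x)) \<in> borel_measurable borel" unfolding sgn_div_norm by measurable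
    then show ?thesis unfolding h_def using r cont
      by (intro borel_measurable_sum borel_measurable_times borel_measurable_inner borel_measurable_const
          borel_measurable_continuous_sgn[where R=r]) auto
  qed
  have "(LINT y:sphere x r|sphere_measure x r. dir_deriv v (outward_normal x r y) y) = integral\<^sup>L (sphere_measure x r) K"
    unfolding set_lebesgue_integral_def K_def using sub
    by (intro Bochner_Integration.integral_cong refl) (auto simp: indicator_def C1_on_dir_deriv[OF D v])
  also have "\<dots> = real DIM('a) / r * (LINT y:ball x r - {x}|lborel. K (x + r *\<^sub>R sgn (y - x)))"
    by (rule integral_sphere_measure) fact+
  also have "(LINT y:ball x r - {x}|lborel. K (x + r *\<^sub>R sgn (y - x))) = (LINT y:ball x r|lborel. h (sgn (y - x)))"
    unfolding set_lebesgue_integral_def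
  proof (intro Bochner_Integration.integral_cong refl)
    fix y
    \<comment> \<open>At \<open>y = x\<close> the left side is cut off by the indicator, and the
      right side vanishes because \<open>h 0 = 0\<close>.\<close>
    show "indicator (ball x r - {x}) y *\<^sub>R K (x + r *\<^sub>R sgn (y - x)) = indicator (ball x r) y *\<^sub>R h (sgn (y - x))"
      using r by (cases "y = x") (auto simp: K_def h_def outward_normal_def dist_norm norm_sgn indicator_def)
  qed
  also have "\<dots> = r ^ DIM('a) * cone_normal_derivative v x r"
    using ball_integral_sgn[OF r hm] by (simp add: cone_normal_derivative_def h_def)
  also have "real DIM('a) / r * (r ^ DIM('a) * cone_normal_derivative v x r) = real DIM('a) * r ^ (DIM('a) - 1) * cone_normal_derivative v x r"
    using r by (cases "DIM('a)") auto
  finally show ?thesis .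
qed

text \<open>A compact ball has positive distance from the complement of \<open>D\<close>, and each
  point of the larger ball outside the smaller one is close to its radial projection. The room is
  needed to differentiate at the radius \<open>r\<close> itself.\<close>

lemma cball_subset_open_enlarge:
  fixes x :: "'a::euclidean_space"
  assumes D: "open D" and sub: "cball x r \<subseteq> D" and r: "r > 0"
  obtains R where "R > r" "cball x R \<subseteq> D"
proof -
  obtain e where e: "e > 0" "(\<Union>y\<in>cball x r. cball y e) \<subseteq> D"
    using compact_subset_open_imp_cball_epsilon_subset[OF compact_cball D sub] by blast
  have "y \<in> D" if y: "y \<in> cball x (r + e)" for y
  proof (cases "y \<in> cball x r")
    case False
    define w where "w = x + r *\<^sub>R sgn (y - x)"
    have "y \<noteq> x" using False r by auto
    then have "y - x = norm (y - x) *\<^sub>R sgn (y - x)" by (simp add: sgn_div_norm)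
    then have "y - w = (norm (y - x) - r) *\<^sub>R sgn (y - x)"
      unfolding w_def by (metis scaleR_diff_left diff_diff_eq)
    then have "dist w y \<le> e" using \<open>y \<noteq> x\<close> y False
      by (simp add: dist_norm norm_minus_commute[of w] norm_minus_commute[of x] norm_sgn)
    then have "y \<in> cball w e" by simp
    moreover have "w \<in> cball x r" using r by (simp add: w_def dist_norm norm_sgn)
    ultimately show ?thesis using e(2) by blast
  qed (use sub in auto)
  then show ?thesis using e(1) by (intro that[of "r + e"]) auto
qed

theorem theorem9:
  fixes D :: "(real ^ 'm) set" and v :: "real ^ 'm \<Rightarrow> real" and \<mu> :: real
  assumes "CARD('m) \<ge> 2"
    and "open D" and "connected D"
    and "\<mu> > 0"
    and "C2_on D v"
    and "\<forall>y\<in>D. laplacian v y - \<mu>\<^sup>2 * v y = 0"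
  shows "\<forall>x\<in>D. \<forall>r>0. closure (ball x r) \<subseteq> D \<longrightarrow>
           (LINT y:sphere x r|sphere_measure x r. dir_deriv v (outward_normal x r y) y) =
             \<mu>\<^sup>2 * (2 * pi * r / \<mu>) powr (real CARD('m) / 2)
               * Bessel_I (real CARD('m) / 2) (\<mu> * r) * v x"
proof (intro ballI allI impI)
  fix x :: "real ^ 'm" and r :: real
  assume r: "r > 0" and "closure (ball x r) \<subseteq> D"
  then have sub: "cball x r \<subseteq> D" by simp
  obtain R where R: "r < R" "cball x R \<subseteq> D"
    using cball_subset_open_enlarge[OF assms(2) sub r] by blast
  have eq: "\<And>y. y \<in> D \<Longrightarrow> laplacian v y = \<mu>\<^sup>2 * v y" using assms(6) by simp
  have v1: "C1_on D v" using assms(5) by (simp add: C2_on_def)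
  \<comment> \<open>The sphere integral and the ball integral of the Laplacian are the same multiple
    of \<open>cone_normal_derivative v x r\<close>.\<close>
  have "(LINT y:sphere x r|sphere_measure x r. dir_deriv v (outward_normal x r y) y) = ball_integral (laplacian v) x r"
    using integral_sphere_normal_derivative[OF assms(2) v1 sub r] ball_integral_laplacian[OF assms(2,5) R(2) r R(1)] by simp
  also have "\<dots> = ball_integral (\<lambda>y. \<mu>\<^sup>2 * v y) x r"
    unfolding ball_integral_def using eq sub by (intro set_lebesgue_integral_cong) (auto simp: subset_iff)
  also have "\<dots> = \<mu>\<^sup>2 * ball_integral v x r" by (simp add: ball_integral_def)
  finally show "(LINT y:sphere x r|sphere_measure x r. dir_deriv v (outward_normal x r y) y) =
             \<mu>\<^sup>2 * (2 * pi * r / \<mu>) powr (real CARD('m) / 2)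
               * Bessel_I (real CARD('m) / 2) (\<mu> * r) * v x"
    using ball_integral_modified_helmholtz[OF _ assms(2,4,5) eq r R] assms(1) by simp
qed

end
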